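(* Let $m \ge 1$, $n=2m$, $q=2^n$. Let $d_1=2^m+1$ and let $d_2=s_2(2^m-1)+1$ be a positive integer, where $s_2$ is an integer with $s_2 \not\equiv \frac12 \pmod{2^m+1}$ ($\frac12$ denoting the inverse of $2$ modulo $2^m+1$). Let $l=\gcd(2s_2-1,2^m+1)$. Then $\mathcal{C}_{q,d_1,d_2}^{\perp}$ is a binary linear code with parameters $[2^n-1,\,3m,\,2^{2m-1}-(2l-1)2^{m-1}]$, and its weight distribution is as follows: \begin{itemize} \item weight $0$: $1$ codeword; \item weight $2^{2m-1}-(2l-1)2^{m-1}$: $\frac{(2^{2m}-1)(2^m-l+1)}{2l^2}$ codewords; \item weight $2^{2m-1}-(l-1)2^{m-1}$: $\frac{(2^{2m}-1)((2^m+2)l-2^m-1)}{l^2}$ codewords; \item weight $2^{2m-1}+2^{m-1}$: $2^{3m}-1+\frac{(2^{2m}-1)(2^{m}+1-(2^{m+1}+3)l)}{2l^2}$ codewords. \end{itemize}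
   Context: Let $p$ be a prime (here $p=2$), $q=p^n$, and let $\theta$ be a fixed primitive element of $\mathbb{F}_q$. For a positive integer $i$, $g_i(x)$ denotes the minimal polynomial of $\theta^i$ over $\mathbb{F}_p$. $\mathcal{C}_{q,d_1,d_2}$ is the cyclic code of length $q-1$ over $\mathbb{F}_p$ with generator polynomial $g_{d_1}(x)g_{d_2}(x)$, i.e. the ideal of $\mathbb{F}_p[x]/(x^{q-1}-1)$ generated by $g_{d_1}(x)g_{d_2}(x)$, where a word $(c_0,\dots,c_{q-2})$ is identified with $\sum_i c_i x^i$. $\mathcal{C}_{q,d_1,d_2}^{\perp}$ is its dual code with respect to the standard inner product. An $[N,k,d]$ code is a linear code of length $N$, dimension $k$ and minimum Hamming distance $d$. The weight distribution lists, for each Hamming weight that occurs, the number of codewords of that weight. *)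

theory Defs
  imports
    "HOL-Library.Cardinality"
    "HOL-Library.Z2"
    "HOL-Number_Theory.Cong"
    "HOL-Number_Theory.Modular_Inverse"
    "Jordan_Normal_Form.VS_Connect"
begin

definition primitive_element :: "'a::finite_field \<Rightarrow> bool" where
  "primitive_element \<theta> \<longleftrightarrow> \<theta> \<noteq> 0 \<and> (\<forall>x. x \<noteq> 0 \<longrightarrow> (\<exists>k::nat. x = \<theta> ^ k))"

(* The binary field is the type bit.  In characteristic 2 the map of_bit is the embedding of the
   prime field, so the definition below is only meaningful for CHAR('a) = 2. *)

definition is_root :: "bit poly \<Rightarrow> 'a::finite_field \<Rightarrow> bool" where
  "is_root f \<alpha> \<longleftrightarrow> poly (map_poly of_bit f) \<alpha> = 0"

definition minimal_poly :: "'a::finite_field \<Rightarrow> bit poly" where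
  "minimal_poly \<alpha> = (THE f. lead_coeff f = 1 \<and> is_root f \<alpha> \<and>
     (\<forall>h. h \<noteq> 0 \<and> is_root h \<alpha> \<longrightarrow> degree f \<le> degree h))"

(* Lowest index = constant coefficient; this is the opposite of the order used by the
   library function poly_of_vec. *)

definition word_poly :: "bit vec \<Rightarrow> bit poly" where
  "word_poly c = (\<Sum>i<dim_vec c. monom (c $ i) i)"

(* A word of length N stands for the residue class of its polynomial modulo x^N - 1; the principal
   ideal generated by the class of g consists of the classes of the multiples of g. *)

definition cyclic_code :: "nat \<Rightarrow> bit poly \<Rightarrow> bit vec set" where
  "cyclic_code N g =
     {c \<in> carrier_vec N. \<exists>h. [word_poly c = g * h] (mod (monom 1 N - 1))}"

definition dual_code :: "nat \<Rightarrow> bit vec set \<Rightarrow> bit vec set" where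
  "dual_code N C = {x \<in> carrier_vec N. \<forall>c\<in>C. scalar_prod x c = 0}"

definition hamming_weight :: "bit vec \<Rightarrow> nat" where
  "hamming_weight c = card {i. i < dim_vec c \<and> c $ i \<noteq> 0}"

definition hamming_distance :: "bit vec \<Rightarrow> bit vec \<Rightarrow> nat" where
  "hamming_distance u v = card {i. i < dim_vec u \<and> u $ i \<noteq> v $ i}"

definition min_distance :: "bit vec set \<Rightarrow> nat" where
  "min_distance C = (LEAST d. \<exists>u\<in>C. \<exists>v\<in>C. u \<noteq> v \<and> hamming_distance u v = d)"

definition is_linear_code :: "nat \<Rightarrow> nat \<Rightarrow> nat \<Rightarrow> bit vec set \<Rightarrow> bool" where
  "is_linear_code N k d C \<longleftrightarrow>
     subspace class_ring C (module_vec TYPE(bit) N) \<and>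
     vectorspace.dim class_ring (module_vec TYPE(bit) N\<lparr>carrier := C\<rparr>) = k \<and>
     min_distance C = d"

(* F_q is the whole type 'a, so q = CARD('a). *)

definition two_zero_code :: "'a::finite_field \<Rightarrow> nat \<Rightarrow> nat \<Rightarrow> bit vec set" where
  "two_zero_code \<theta> d\<^sub>1 d\<^sub>2 =
     cyclic_code (CARD('a) - 1) (minimal_poly (\<theta> ^ d\<^sub>1) * minimal_poly (\<theta> ^ d\<^sub>2))"

end

theory Submission
  imports Defs
begin

text \<open>Put \<open>Q = 2 ^ m\<close>, let \<open>K\<close> be the subfield with \<open>Q\<close> elements and \<open>U\<close> the group of
  \<open>(Q + 1)\<close>-th roots of unity. By Delsarte duality the codewords are
  \<open>x \<mapsto> Tr (a\<^sup>2 x\<^bsup>Q+1\<^esup> + b x\<^bsup>d\<^esup> + (b x\<^bsup>d\<^esup>)\<^bsup>Q\<^esup>)\<close> with \<open>a \<in> K\<close> and \<open>b\<close> in the whole field.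
  Writing \<open>x = y z\<close> with \<open>y \<in> K\<close>, \<open>z \<in> U\<close>, the argument has the trace of
  \<open>y (a + b z\<^bsup>d\<^esup> + (b z\<^bsup>d\<^esup>)\<^bsup>Q\<^esup>)\<close>, which is linear in \<open>y\<close>, so the weight only depends on the number of
  \<open>z \<in> U\<close> for which the bracket vanishes. The map \<open>z \<mapsto> z\<^bsup>d\<^esup>\<close> is \<open>l\<close>-to-one on \<open>U\<close>, and
  \<open>b w + (b w)\<^bsup>Q\<^esup> = a\<close> is a quadratic equation for \<open>w \<in> U\<close>; so this number is \<open>0\<close>, \<open>l\<close> or \<open>2 l\<close>.
  The first two moments of the number of solutions give the frequencies.\<close>

declare add_bit_eq_xor [simp del] mult_bit_eq_and [simp del]

subsection \<open>Binary linear codes and their duals\<close>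

lemma bit_add_eq_0_iff: "x + y = 0 \<longleftrightarrow> x = y" for x y :: bit
  by (cases x; cases y) auto

text \<open>The bijection \<open>t\<close> exchanges the elements with and without \<open>P\<close>.
  With a translation for \<open>t\<close>, this says that a nonzero linear functional takes the
  value 1 on exactly half of a binary space.\<close>

lemma card_balanced:
  assumes "finite G" and "bij_betw t G G" and "\<And>x. x \<in> G \<Longrightarrow> P (t x) \<longleftrightarrow> \<not> P x"
  shows "2 * card {x \<in> G. P x} = card G"
proof -
  have "t ` {x \<in> G. P x} = {x \<in> G. \<not> P x}"
  proof (intro equalityI subsetI)
    fix y assume y: "y \<in> {x \<in> G. \<not> P x}"
    then obtain x where "x \<in> G" "y = t x"
      using bij_betw_imp_surj_on[OF assms(2)] by blast
    then show "y \<in> t ` {x \<in> G. P x}"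
      using y assms(3) by blast
  qed (use assms bij_betw_apply[OF assms(2)] in auto)
  moreover have "inj_on t {x \<in> G. P x}"
    using bij_betw_imp_inj_on[OF assms(2)] by (rule inj_on_subset) auto
  ultimately have "card {x \<in> G. P x} = card {x \<in> G. \<not> P x}"
    by (metis card_image)
  moreover have "card G = card {x \<in> G. P x} + card {x \<in> G. \<not> P x}"
    using assms(1) by (subst card_Un_disjoint[symmetric]) (auto intro!: arg_cong[where f = card])
  ultimately show ?thesis
    by simp
qed

lemma card_UNIV_bit: "CARD(bit) = 2" and finite_UNIV_bit: "finite (UNIV :: bit set)"
proof -
  have U: "(UNIV :: bit set) = {0, 1}"
    using bit_not_zero_iff by auto
  show "CARD(bit) = 2"
    unfolding U by simp
  show "finite (UNIV :: bit set)"
    unfolding U by simp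
qed

lemma finite_carrier_bit_vec: "finite (carrier_vec N :: bit vec set)"
  and card_carrier_bit_vec: "card (carrier_vec N :: bit vec set) = 2 ^ N"
proof -
  have eq: "carrier_vec N = vec_of_list ` {xs :: bit list. set xs \<subseteq> UNIV \<and> length xs = N}"
    by (force simp: image_iff intro: exI[of _ "list_of_vec _"] carrier_vecI
        dest: carrier_vecD simp: vec_list)
  have inj: "inj_on vec_of_list {xs :: bit list. set xs \<subseteq> UNIV \<and> length xs = N}"
    by (rule inj_on_inverseI[of _ list_of_vec]) (simp add: list_vec)
  show "finite (carrier_vec N :: bit vec set)"
    unfolding eq by (intro finite_imageI finite_lists_length_eq finite_UNIV_bit)
  show "card (carrier_vec N :: bit vec set) = 2 ^ N"
    unfolding eq by (subst card_image[OF inj], subst card_lists_length_eq) (simp_all add: card_UNIV_bit finite_UNIV_bit)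
qed

text \<open>Over the field with two elements the only scalars are 0 and 1, so an additively closed
  set containing the zero word is already a subspace.\<close>

definition closed_code :: "nat \<Rightarrow> bit vec set \<Rightarrow> bool" where
  "closed_code N C \<longleftrightarrow> C \<subseteq> carrier_vec N \<and> 0\<^sub>v N \<in> C \<and> (\<forall>x\<in>C. \<forall>y\<in>C. x + y \<in> C)"

lemma bit_vec_add_self: "x \<in> carrier_vec N \<Longrightarrow> x + x = 0\<^sub>v N" for x :: "bit vec"
  by (intro eq_vecI) (auto simp: bit_add_eq_0_iff)

lemma bit_vec_add_add_self:
  assumes "x \<in> carrier_vec N" "y \<in> carrier_vec N"
  shows "x + (x + y) = (y :: bit vec)"
  using assms by (simp add: assoc_add_vec[symmetric] bit_vec_add_self)

lemma bij_betw_add_code: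
  assumes "closed_code N C" "h \<in> C"
  shows "bij_betw ((+) h) C C"
  using assms by (intro bij_betwI[where g = "(+) h"])
    (auto simp: closed_code_def bit_vec_add_add_self subset_iff)

lemma closed_code_carrier: "closed_code N (carrier_vec N)"
  by (auto simp: closed_code_def)

lemma closed_code_dual:
  assumes "closed_code N H"
  shows "closed_code N (dual_code N H)"
  using assms by (auto simp: closed_code_def dual_code_def subset_iff add_scalar_prod_distrib[of _ N])

text \<open>Double counting of the pairs \<open>(x, h)\<close> with product 1: every
  \<open>x\<close> outside the dual has \<open>card H / 2\<close> partners, every nonzero
  \<open>h\<close> has \<open>2 ^ N / 2\<close>, and all other elements have none.\<close>

lemma card_dual_code:
  assumes H: "closed_code N H"
  shows "card H * card (dual_code N H) = 2 ^ N"
proof -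
  let ?V = "carrier_vec N :: bit vec set" and ?D = "dual_code N H"
  note finV = finite_carrier_bit_vec[of N]
  have HV: "H \<subseteq> ?V" and DV: "?D \<subseteq> ?V"
    using H by (auto simp: closed_code_def dual_code_def)
  have finH: "finite H" and finD: "finite ?D"
    using finV HV DV finite_subset by blast+
  have by_row: "2 * card {h \<in> H. x \<bullet> h = 1} = (if x \<in> ?D then 0 else card H)" if x: "x \<in> ?V" for x
  proof (cases "x \<in> ?D")
    case True
    then have "{h \<in> H. x \<bullet> h = 1} = {}"
      by (auto simp: dual_code_def)
    then show ?thesis
      using True by (metis card.empty mult_0_right)
  next
    case False
    then obtain h where h: "h \<in> H" "x \<bullet> h = 1"
      using x by (auto simp: dual_code_def)
    have "2 * card {h \<in> H. x \<bullet> h = 1} = card H"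
    proof (rule card_balanced[OF finH bij_betw_add_code[OF H h(1)]])
      fix y assume "y \<in> H"
      then have "x \<bullet> (h + y) = 1 + x \<bullet> y"
        using that h HV by (subst scalar_prod_add_distrib[of _ N]) auto
      then show "(x \<bullet> (h + y) = 1) = (\<not> x \<bullet> y = 1)"
        by (cases "x \<bullet> y") auto
    qed
    then show ?thesis
      using False by simp
  qed
  have by_col: "2 * card {x \<in> ?V. x \<bullet> h = 1} = (if h = 0\<^sub>v N then 0 else 2 ^ N)" if "h \<in> H" for h
  proof (cases "h = 0\<^sub>v N")
    case True
    then have "{x \<in> ?V. x \<bullet> h = 1} = {}"
      by auto
    then show ?thesis
      using True by (metis card.empty mult_0_right)
  next
    case False
    have hV: "h \<in> ?V"
      using that HV by auto
    then obtain i where i: "i < N" "h $ i = 1"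
      using False by (metis bit_not_zero_iff carrier_vecD eq_vecI index_zero_vec)
    \<comment> \<open>Since entry \<open>i\<close> of \<open>h\<close> is 1, adding the
      \<open>i\<close>-th unit vector flips the product with \<open>h\<close>.\<close>
    have "2 * card {x \<in> ?V. x \<bullet> h = 1} = card ?V"
    proof (rule card_balanced[OF finV bij_betw_add_code[OF closed_code_carrier, of "unit_vec N i"]])
      fix y :: "bit vec" assume y: "y \<in> ?V"
      then have "(unit_vec N i + y) \<bullet> h = 1 + y \<bullet> h"
        using hV i by (subst add_scalar_prod_distrib[of _ N]) auto
      then show "((unit_vec N i + y) \<bullet> h = 1) = (\<not> y \<bullet> h = 1)"
        by (cases "y \<bullet> h") auto
    qed auto
    then show ?thesis
      using False by (simp add: card_carrier_bit_vec)
  qed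
  have "(\<Sum>x\<in>?V. 2 * card {h \<in> H. x \<bullet> h = 1}) = (\<Sum>h\<in>H. 2 * card {x \<in> ?V. x \<bullet> h = 1})"
    unfolding sum_distrib_left[symmetric] using sum.swap_restrict[OF finV finH, of "\<lambda>_ _. 1::nat"]
    by simp
  moreover have "(\<Sum>x\<in>?V. 2 * card {h \<in> H. x \<bullet> h = 1}) = card (?V - ?D) * card H"
    using DV finV by (simp add: by_row sum.If_cases Int_absorb1 Diff_eq cong: sum.cong)
  moreover have "(\<Sum>h\<in>H. 2 * card {x \<in> ?V. x \<bullet> h = 1}) = card (H - {0\<^sub>v N}) * 2 ^ N"
    using finH by (simp add: by_col sum.If_cases Diff_eq cong: sum.cong)
  moreover have "card (?V - ?D) = 2 ^ N - card ?D"
    using card_Diff_subset[OF finD DV] by (simp add: card_carrier_bit_vec)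
  moreover have "card (H - {0\<^sub>v N}) = card H - 1"
    using H finH by (simp add: closed_code_def)
  ultimately have "(2 ^ N - card ?D) * card H = (card H - 1) * 2 ^ N"
    by simp
  moreover have "card ?D \<le> 2 ^ N"
    using card_mono[OF finV DV] by (simp add: card_carrier_bit_vec)
  moreover have "card H \<ge> 1"
    using H finH by (metis One_nat_def Suc_leI card_gt_0_iff closed_code_def empty_iff)
  \<comment> \<open>The two bounds make the truncated differences genuine, so the equation can be
    solved over the integers.\<close>
  ultimately have "int (2 ^ N - card ?D) * int (card H) = int (card H - 1) * 2 ^ N"
    by (metis of_nat_mult of_nat_numeral of_nat_power)
  then have "int (card H * card ?D) = int (2 ^ N)"
    using \<open>card ?D \<le> 2 ^ N\<close> \<open>card H \<ge> 1\<close> by (simp add: of_nat_diff algebra_simps)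
  then show ?thesis
    by linarith
qed

text \<open>One inclusion is symmetry of the inner product; applying the cardinality formula to
  \<open>H\<close> and to its dual shows that both sides have equal size.\<close>

lemma dual_code_dual_code:
  assumes H: "closed_code N H"
  shows "dual_code N (dual_code N H) = H"
proof -
  let ?D = "dual_code N H"
  have "card H * card ?D = card (dual_code N ?D) * card ?D"
    using card_dual_code[OF H] card_dual_code[OF closed_code_dual[OF H]] by (simp add: mult.commute)
  moreover have "card ?D \<noteq> 0"
    using card_dual_code[OF H] by (intro notI) simp
  ultimately have "card H = card (dual_code N ?D)"
    by simp
  moreover have "H \<subseteq> dual_code N ?D"
    using H by (auto simp: closed_code_def dual_code_def subset_iff)
      (metis comm_scalar_prod)
  moreover have "finite (dual_code N ?D)"
    by (rule finite_subset[OF _ finite_carrier_bit_vec[of N]]) (auto simp: dual_code_def)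
  ultimately show ?thesis
    by (metis card_subset_eq)
qed

lemma hamming_distance_eq_weight:
  assumes "x \<in> carrier_vec N" "y \<in> carrier_vec N"
  shows "hamming_distance x y = hamming_weight (x + y)"
  using assms unfolding hamming_distance_def hamming_weight_def
  by (intro arg_cong[where f = card]) (auto simp: bit_add_eq_0_iff simp del: bit_not_zero_iff)

text \<open>The distance of two words is the weight of their sum, and the sum of distinct codewords
  is a nonzero codeword.\<close>

lemma min_distance_eqI:
  assumes C: "closed_code N C" and c: "c \<in> C" "c \<noteq> 0\<^sub>v N" "hamming_weight c = w"
    and min: "\<And>c. c \<in> C \<Longrightarrow> c \<noteq> 0\<^sub>v N \<Longrightarrow> w \<le> hamming_weight c"
  shows "min_distance C = w"
  unfolding min_distance_def
proof (rule Least_equality)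
  have "hamming_distance c (0\<^sub>v N) = w"
    using c C by (subst hamming_distance_eq_weight[of _ N]) (auto simp: closed_code_def subset_iff)
  then show "\<exists>u\<in>C. \<exists>v\<in>C. u \<noteq> v \<and> hamming_distance u v = w"
    using c C by (auto simp: closed_code_def)
next
  fix d assume "\<exists>u\<in>C. \<exists>v\<in>C. u \<noteq> v \<and> hamming_distance u v = d"
  then obtain u v where uv: "u \<in> C" "v \<in> C" "u \<noteq> v" "hamming_distance u v = d"
    by blast
  have V: "u \<in> carrier_vec N" "v \<in> carrier_vec N"
    using uv C by (auto simp: closed_code_def)
  have "u + v \<noteq> 0\<^sub>v N"
  proof
    assume "u + v = 0\<^sub>v N"
    then have "u + (u + v) = u"
      using V by simp
    then show False
      using bit_vec_add_add_self[OF V] uv(3) by simp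
  qed
  then show "w \<le> d"
    using min[of "u + v"] uv C V by (auto simp: hamming_distance_eq_weight closed_code_def)
qed

lemma subspace_closed_code:
  assumes "closed_code N C"
  shows "subspace class_ring C (module_vec TYPE(bit) N)"
proof -
  interpret vec_space "TYPE(bit)" N .
  have "a \<cdot>\<^sub>v v \<in> C" if "v \<in> C" for a v
    using that assms by (cases a) (auto simp: closed_code_def subset_iff)
  then show ?thesis
    using assms by (auto simp: closed_code_def subspace_def submodule_def
        module_vec_simps module_axioms vectorspace_axioms)
qed

text \<open>Coordinates with respect to a basis \<open>B\<close> put \<open>C\<close> in bijection
  with the functions from \<open>B\<close> to \<open>bit\<close>, so
  \<open>card C = 2 ^ card B\<close>.\<close>

lemma dim_closed_code:
  assumes C: "closed_code N C" and card: "card C = 2 ^ k"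
  shows "vectorspace.dim class_ring (module_vec TYPE(bit) N\<lparr>carrier := C\<rparr>) = k"
proof -
  interpret vec_space "TYPE(bit)" N .
  interpret W: vectorspace "class_ring :: bit ring" "module_vec TYPE(bit) N\<lparr>carrier := C\<rparr>"
    using subspace_is_vs[OF subspace_closed_code[OF C]] .
  have finC: "finite C"
    using card by (intro card_ge_0_finite) simp
  have "W.fin_dim"
    unfolding W.fin_dim_def using finC W.span_is_subset2[of C] W.in_own_span[of C]
    by (intro exI[of _ C]) auto
  then obtain B where B: "finite B" "W.basis B"
    using W.finite_basis_exists by auto
  then have BC: "B \<subseteq> C"
    by (simp add: W.basis_def)
  have crit: "\<exists>!a. a \<in> B \<rightarrow>\<^sub>E (UNIV :: bit set) \<and> W.lincomb a B = v" if "v \<in> C" for v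
    using W.basis_criterion[OF B(1)] B(2) BC that by simp
  have "bij_betw (\<lambda>a. W.lincomb a B) (B \<rightarrow>\<^sub>E (UNIV :: bit set)) C"
    unfolding bij_betw_def
  proof
    have mem: "W.lincomb a B \<in> C" for a
      using W.lincomb_closed[of B a] BC by (simp add: Pi_def)
    then show "inj_on (\<lambda>a. W.lincomb a B) (B \<rightarrow>\<^sub>E (UNIV :: bit set))"
      using crit by (intro inj_onI) metis
    show "(\<lambda>a. W.lincomb a B) ` (B \<rightarrow>\<^sub>E (UNIV :: bit set)) = C"
      using crit mem by blast
  qed
  then have "card C = card (B \<rightarrow>\<^sub>E (UNIV :: bit set))"
    by (simp add: bij_betw_same_card)
  also have "\<dots> = 2 ^ card B"
    using B(1) by (simp add: card_funcsetE card_UNIV_bit)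
  finally have "card B = k"
    using card by simp
  then show ?thesis
    using W.dim_basis[OF B] by simp
qed

subsection \<open>Minimal polynomials and cyclic codes\<close>

text \<open>Every element is fixed by the power \<open>CARD('a)\<close>; for -1 and an even exponent
  this gives 1 = -1.\<close>

lemma char_2_add_self:
  assumes "even CARD('a)"
  shows "(x :: 'a::finite_field) + x = 0"
proof -
  have "(1 :: 'a) = (- 1) ^ CARD('a)"
    using assms by simp
  also have "\<dots> = - 1"
    by (rule finite_field_power_card_eq_same)
  finally have "(1 :: 'a) + 1 = 0"
    by (simp add: eq_neg_iff_add_eq_0)
  then have "x * (1 + 1) = 0"
    by simp
  then show ?thesis
    unfolding distrib_left by simp
qed

lemma char_2_minus:
  assumes "even CARD('a)"
  shows "(x :: 'a::finite_field) - y = x + y"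
  using char_2_add_self[OF assms, of y] by (simp add: diff_eq_eq add.assoc)

lemma of_bit_add:
  assumes "even CARD('a)"
  shows "(of_bit (x + y) :: 'a::finite_field) = of_bit x + of_bit y"
  using char_2_add_self[OF assms, of 1] by (cases x; cases y) auto

text \<open>The evaluation inside \<open>is_root\<close>, named because in characteristic 2 it is a
  ring homomorphism in \<open>f\<close>.\<close>

definition bit_eval :: "bit poly \<Rightarrow> 'a::finite_field \<Rightarrow> 'a" where
  "bit_eval f \<alpha> = poly (map_poly of_bit f) \<alpha>"

lemma is_root_iff_bit_eval: "is_root f \<alpha> \<longleftrightarrow> bit_eval f \<alpha> = 0"
  by (simp add: is_root_def bit_eval_def)

lemma bit_eval_add:
  assumes "even CARD('a)"
  shows "bit_eval (f + g) (\<alpha> :: 'a::finite_field) = bit_eval f \<alpha> + bit_eval g \<alpha>"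
proof -
  have z: "of_bit 0 = (0 :: 'a)"
    by simp
  have "map_poly of_bit (f + g) = map_poly of_bit f + (map_poly of_bit g :: 'a poly)"
    by (intro poly_eqI) (simp only: coeff_map_poly[where f = of_bit, OF z] coeff_add of_bit_add[OF assms])
  then show ?thesis
    by (simp add: bit_eval_def)
qed

lemma bit_eval_0 [simp]: "bit_eval 0 \<alpha> = 0"
  by (simp add: bit_eval_def)

lemma bit_eval_monom: "bit_eval (monom c k) \<alpha> = of_bit c * \<alpha> ^ k"
  by (simp add: bit_eval_def map_poly_monom poly_monom)

lemma bit_eval_sum:
  assumes "even CARD('a)"
  shows "bit_eval (\<Sum>i\<in>I. f i) (\<alpha> :: 'a::finite_field) = (\<Sum>i\<in>I. bit_eval (f i) \<alpha>)"
  by (induction I rule: infinite_finite_induct) (simp_all add: bit_eval_add[OF assms])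

lemma bit_eval_mult:
  assumes "even CARD('a)"
  shows "bit_eval (f * g) (\<alpha> :: 'a::finite_field) = bit_eval f \<alpha> * bit_eval g \<alpha>"
proof (induction f)
  case (pCons c f)
  have smult: "bit_eval (Polynomial.smult c g) \<alpha> = of_bit c * bit_eval g \<alpha>"
    by (cases c) auto
  have shift: "bit_eval (pCons c f) \<alpha> = of_bit c + \<alpha> * bit_eval f \<alpha>" for c f
    by (simp add: bit_eval_def map_poly_pCons)
  show ?case
    by (simp add: bit_eval_add[OF assms] smult shift pCons.IH algebra_simps)
qed simp

lemma bit_eval_diff:
  assumes "even CARD('a)"
  shows "bit_eval (f - g) (\<alpha> :: 'a::finite_field) = bit_eval f \<alpha> - bit_eval g \<alpha>"
  using bit_eval_add[OF assms, of "f - g" g \<alpha>] by simp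

lemma bit_eval_1 [simp]: "bit_eval 1 \<alpha> = 1"
  by (simp add: bit_eval_def)

text \<open>This justifies the definite description. A nonzero annihilator of least degree exists
  and is monic because 1 is the only nonzero bit. The difference of two such polynomials would
  vanish at \<alpha> and have smaller degree.\<close>

lemma minimal_poly_spec:
  assumes even: "even CARD('a)" and \<alpha>: "(\<alpha> :: 'a::finite_field) \<noteq> 0"
  defines "f \<equiv> minimal_poly \<alpha>"
  shows "lead_coeff f = 1 \<and> bit_eval f \<alpha> = 0 \<and> (\<forall>h. h \<noteq> 0 \<and> bit_eval h \<alpha> = 0 \<longrightarrow> degree f \<le> degree h)"
proof -
  define P where "P f \<longleftrightarrow> lead_coeff f = 1 \<and> bit_eval f \<alpha> = 0 \<and>
    (\<forall>h. h \<noteq> 0 \<and> bit_eval h \<alpha> = 0 \<longrightarrow> degree f \<le> degree h)" for f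
  \<comment> \<open>The polynomial X^q - X vanishes on the whole field, so some nonzero annihilator
    exists.\<close>
  have "bit_eval (monom 1 CARD('a) - monom 1 1) \<alpha> = 0"
    by (simp add: bit_eval_diff[OF even] bit_eval_monom finite_field_power_card_eq_same)
  moreover have "monom 1 CARD('a) - monom 1 1 \<noteq> (0 :: bit poly)"
  proof
    assume "monom 1 CARD('a) - monom 1 1 = (0 :: bit poly)"
    then have "degree (monom (1::bit) CARD('a)) = degree (monom (1::bit) 1)"
      by (metis eq_iff_diff_eq_0)
    then show False
      using even by (simp add: degree_monom_eq)
  qed
  ultimately obtain f0 where f0: "f0 \<noteq> 0 \<and> bit_eval f0 \<alpha> = 0"
    "\<And>h. h \<noteq> 0 \<and> bit_eval h \<alpha> = 0 \<Longrightarrow> degree f0 \<le> degree h"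
    using ex_has_least_nat[of "\<lambda>f. f \<noteq> 0 \<and> bit_eval f \<alpha> = 0" _ degree] by blast
  moreover have "lead_coeff f0 = 1"
    using f0(1) by (metis bit_not_zero_iff leading_coeff_neq_0)
  ultimately have "P f0"
    by (auto simp: P_def)
  have unique: "f1 = f2" if "P f1" "P f2" for f1 f2
  proof (rule ccontr)
    assume neq: "f1 \<noteq> f2"
    have nz: "f1 \<noteq> 0" "f2 \<noteq> 0"
      using that by (auto simp: P_def)
    have deg: "degree f1 = degree f2"
      using that nz unfolding P_def by (meson le_antisym)
    have "degree f1 \<le> degree (f1 - f2)"
      using that neq by (auto simp: P_def bit_eval_diff[OF even])
    moreover have "degree (f1 - f2) \<le> degree f1"
      using degree_diff_le_max[of f1 f2] deg by simp
    ultimately have "coeff (f1 - f2) (degree f1) \<noteq> 0"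
      using neq by (metis eq_iff_diff_eq_0 le_antisym leading_coeff_0_iff)
    moreover have "coeff (f1 - f2) (degree f1) = 0"
      using that deg by (simp add: P_def bit_add_eq_0_iff)
    ultimately show False
      by simp
  qed
  have "P (THE f. P f)"
    by (rule theI[of P f0]) (use \<open>P f0\<close> unique in blast)+
  then show ?thesis
    unfolding f_def minimal_poly_def is_root_iff_bit_eval P_def by simp
qed

text \<open>The remainder of \<open>h\<close> modulo the minimal polynomial also vanishes at
  \<alpha> and has smaller degree, hence is zero.\<close>

lemma minimal_poly_dvd_iff:
  assumes even: "even CARD('a)" and \<alpha>: "(\<alpha> :: 'a::finite_field) \<noteq> 0"
  shows "minimal_poly \<alpha> dvd h \<longleftrightarrow> bit_eval h \<alpha> = 0"
proof
  let ?f = "minimal_poly \<alpha>"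
  note f = minimal_poly_spec[OF even \<alpha>]
  {
    assume "?f dvd h"
    then show "bit_eval h \<alpha> = 0"
      using f by (auto simp: bit_eval_mult[OF even])
  next
    assume h: "bit_eval h \<alpha> = 0"
    have "bit_eval (h div ?f * ?f + h mod ?f) \<alpha> = 0"
      using h by simp
    then have "bit_eval (h mod ?f) \<alpha> = 0"
      using f by (simp only: bit_eval_add[OF even] bit_eval_mult[OF even]) simp
    moreover have "?f \<noteq> 0"
      using f by auto
    ultimately have "h mod ?f = 0"
      using f degree_mod_less[of ?f h] by (metis leD)
    then show "?f dvd h"
      by (simp add: dvd_eq_mod_eq_0)
  }
qed

text \<open>No coprimality argument is needed: the minimal polynomial of \<open>\<alpha>\<close> divides
  a polynomial vanishing at \<open>\<alpha>\<close> but not at \<open>\<beta>\<close>.\<close>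

lemma minimal_poly_mult_dvd_iff:
  assumes even: "even CARD('a)" and \<alpha>: "(\<alpha> :: 'a::finite_field) \<noteq> 0" and \<beta>: "(\<beta> :: 'a) \<noteq> 0"
    and g: "bit_eval g \<alpha> = 0" "bit_eval g \<beta> \<noteq> 0"
  shows "minimal_poly \<alpha> * minimal_poly \<beta> dvd h \<longleftrightarrow> bit_eval h \<alpha> = 0 \<and> bit_eval h \<beta> = 0"
proof
  assume "minimal_poly \<alpha> * minimal_poly \<beta> dvd h"
  then show "bit_eval h \<alpha> = 0 \<and> bit_eval h \<beta> = 0"
    using minimal_poly_dvd_iff[OF even \<alpha>] minimal_poly_dvd_iff[OF even \<beta>]
    by (meson dvd_mult_left dvd_mult_right)
next
  assume h: "bit_eval h \<alpha> = 0 \<and> bit_eval h \<beta> = 0"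
  have "minimal_poly \<alpha> dvd g"
    using g minimal_poly_dvd_iff[OF even \<alpha>] by blast
  then have \<beta>_nonroot: "bit_eval (minimal_poly \<alpha>) \<beta> \<noteq> 0"
    using g(2) by (auto simp: bit_eval_mult[OF even])
  obtain k where k: "h = minimal_poly \<alpha> * k"
    using h minimal_poly_dvd_iff[OF even \<alpha>] by blast
  then have "bit_eval k \<beta> = 0"
    using h \<beta>_nonroot by (simp add: bit_eval_mult[OF even])
  then have "minimal_poly \<beta> dvd k"
    using minimal_poly_dvd_iff[OF even \<beta>] by blast
  then show "minimal_poly \<alpha> * minimal_poly \<beta> dvd h"
    using k by (simp add: mult_dvd_mono)
qed

lemma bit_eval_word_poly:
  assumes "even CARD('a)" and "c \<in> carrier_vec N"
  shows "bit_eval (word_poly c) (\<alpha> :: 'a::finite_field) = (\<Sum>i<N. of_bit (c $ i) * \<alpha> ^ i)"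
  using assms unfolding word_poly_def by (simp add: bit_eval_sum bit_eval_monom)

text \<open>As \<alpha> and \<beta> are \<open>N\<close>-th roots of unity, the generator divides
  X^N - 1. Membership in the ideal is therefore plain divisibility by the generator, that is,
  vanishing at \<alpha> and \<beta>.\<close>

lemma cyclic_code_minimal_poly_mult:
  assumes even: "even CARD('a)" and \<alpha>: "(\<alpha> :: 'a::finite_field) ^ N = 1" and \<beta>: "(\<beta> :: 'a) ^ N = 1"
    and N: "N > 0" and g: "bit_eval g \<alpha> = 0" "bit_eval g \<beta> \<noteq> 0"
  shows "cyclic_code N (minimal_poly \<alpha> * minimal_poly \<beta>) =
    {c \<in> carrier_vec N. (\<Sum>i<N. of_bit (c $ i) * \<alpha> ^ i) = 0 \<and> (\<Sum>i<N. of_bit (c $ i) * \<beta> ^ i) = 0}"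
proof -
  let ?g = "minimal_poly \<alpha> * minimal_poly \<beta>" and ?M = "monom 1 N - 1 :: bit poly"
  have nz: "\<alpha> \<noteq> 0" "\<beta> \<noteq> 0"
    using \<alpha> \<beta> N by (auto simp: power_0_left)
  note iff = minimal_poly_mult_dvd_iff[OF even nz g]
  have "?g dvd ?M"
    unfolding iff using \<alpha> \<beta> by (simp add: bit_eval_diff[OF even] bit_eval_monom)
  have "(\<exists>h. [f = ?g * h] (mod ?M)) \<longleftrightarrow> ?g dvd f" for f
  proof
    assume "\<exists>h. [f = ?g * h] (mod ?M)"
    then obtain h where "[f = ?g * h] (mod ?M)"
      by blast
    then have "[f = ?g * h] (mod ?g)"
      using \<open>?g dvd ?M\<close> cong_dvd_modulus by blast
    then show "?g dvd f"
      by (metis cong_dvd_iff dvd_refl dvd_triv_left)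
  qed (metis cong_refl dvdE)
  then show ?thesis
    by (auto simp: cyclic_code_def iff bit_eval_word_poly[OF even])
qed

subsection \<open>A field with a subfield of index two in characteristic two\<close>

text \<open>Here \<open>t\<close> plays the role of \<open>s\<^sub>2\<close>. Modulo
  \<open>2 ^ m + 1\<close> the number \<open>t * (2 ^ m - 1) + 1\<close> is 1 - 2t, so the last
  assumption says that \<open>t\<close> is not the inverse of 2.\<close>

locale quadratic_char_2 =
  fixes \<theta> :: "'a::finite_field" and m t :: nat
  assumes m_pos: "m \<ge> 1" and card_UNIV: "CARD('a) = 2 ^ (2 * m)"
    and primitive: "primitive_element \<theta>"
    and not_dvd: "\<not> 2 ^ m + 1 dvd t * (2 ^ m - 1) + 1"
begin

definition Q :: nat where "Q = 2 ^ m"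
definition N :: nat where "N = 2 ^ (2 * m) - 1"
definition d :: nat where "d = t * (Q - 1) + 1"

lemma even_card: "even CARD('a)"
  using m_pos by (simp add: card_UNIV)

lemma Q_ge_2: "Q \<ge> 2"
  using power_increasing[OF m_pos, of "2::nat"] by (simp add: Q_def)

lemma even_Q: "even Q"
  using m_pos by (simp add: Q_def)

lemma Q_square: "2 ^ (2 * m) = Q * Q"
  by (simp add: Q_def power_add mult_2)

lemma N_factor: "N = (Q - 1) * (Q + 1)"
  unfolding N_def Q_square by (simp add: algebra_simps)

lemma N_pos: "N > 0"
  using Q_ge_2 by (simp add: N_factor)

lemma card_UNIV_eq: "CARD('a) = Suc N"
  by (simp add: card_UNIV N_def)

lemma Q_Suc_not_dvd_d: "\<not> Q + 1 dvd d"
  using not_dvd by (simp add: Q_def d_def)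

lemmas add_self [simp] = char_2_add_self[OF even_card]
lemmas minus_eq_add = char_2_minus[OF even_card]

lemma add_eq_0_iff_eq: "x + y = 0 \<longleftrightarrow> x = y" for x y :: 'a
  by (metis minus_eq_add right_minus_eq)

lemma add_power_2_power: "(x + y) ^ (2 ^ k) = x ^ (2 ^ k) + y ^ (2 ^ k)" for x y :: 'a
proof (induction k)
  case (Suc k)
  have sq: "(a + b) ^ 2 = a ^ 2 + b ^ 2" for a b :: 'a
  proof -
    have "(a + b) ^ 2 = a ^ 2 + b ^ 2 + (a * b + a * b)"
      by (simp only: power2_eq_square distrib_left distrib_right ac_simps)
    then show ?thesis
      by simp
  qed
  show ?case
    unfolding power_Suc2 power_mult Suc.IH sq ..
qed simp

lemma add_power_Q: "(x + y) ^ Q = x ^ Q + y ^ Q" for x y :: 'a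
  by (simp add: Q_def add_power_2_power)

lemma power_Q_Q: "(x ^ Q) ^ Q = x" for x :: 'a
  using finite_field_power_card_eq_same[of x] unfolding card_UNIV Q_square
  unfolding power_mult .

lemma power_N: "x \<noteq> 0 \<Longrightarrow> x ^ N = 1" for x :: 'a
  using finite_field_power_card_eq_same[of x] unfolding card_UNIV_eq power_Suc by simp

section \<open>Powers of the primitive element and roots of unity\<close>

lemma theta_nonzero: "\<theta> \<noteq> 0"
  using primitive by (simp add: primitive_element_def)

lemma theta_power_mod: "\<theta> ^ k = \<theta> ^ (k mod N)"
proof -
  have "\<theta> ^ k = \<theta> ^ (k mod N + N * (k div N))"
    by simp
  then show ?thesis
    unfolding power_add power_mult power_N[OF theta_nonzero] by simp
qed

lemma bij_betw_theta: "bij_betw (\<lambda>i. \<theta> ^ i) {..<N} (UNIV - {0})"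
proof -
  have "(\<lambda>i. \<theta> ^ i) ` {..<N} = UNIV - {0}"
  proof (intro equalityI subsetI)
    fix x :: 'a assume "x \<in> UNIV - {0}"
    then obtain k where "x = \<theta> ^ k"
      using primitive by (auto simp: primitive_element_def)
    then show "x \<in> (\<lambda>i. \<theta> ^ i) ` {..<N}"
      using theta_power_mod[of k] N_pos by auto
  qed (auto simp: theta_nonzero)
  moreover have "card (UNIV - {0 :: 'a}) = N"
    by (simp add: card_Diff_subset card_UNIV_eq)
  ultimately show ?thesis
    by (simp add: bij_betw_def eq_card_imp_inj_on)
qed

lemma theta_power_eq_1_iff: "\<theta> ^ k = 1 \<longleftrightarrow> N dvd k"
proof
  assume "\<theta> ^ k = 1"
  then have "\<theta> ^ (k mod N) = \<theta> ^ 0"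
    using theta_power_mod[of k] by simp
  then have "k mod N = 0"
    using inj_onD[OF bij_betw_imp_inj_on[OF bij_betw_theta], of "k mod N" 0] N_pos by simp
  then show "N dvd k"
    by auto
qed (use power_N[OF theta_nonzero] in \<open>auto simp: power_mult\<close>)

lemma theta_power_cases:
  fixes x :: 'a assumes "x \<noteq> 0"
  obtains k where "x = \<theta> ^ k"
  using assms primitive by (auto simp: primitive_element_def)

text \<open>With \<open>N = f * e\<close>, the roots are exactly the powers of \<theta> with
  exponents \<open>f * j\<close>, where \<open>j < e\<close>.\<close>

lemma card_roots_of_unity:
  assumes "e dvd N"
  shows "card {x :: 'a. x ^ e = 1} = e"
proof -
  obtain f where f: "N = f * e"
    using assms by (metis dvdE mult.commute)
  have pos: "e > 0" "f > 0"
    using N_pos f by auto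
  have "{x :: 'a. x ^ e = 1} = (\<lambda>i. \<theta> ^ i) ` ((*) f ` {..<e})"
  proof (intro equalityI subsetI)
    fix x :: 'a assume x: "x \<in> {x. x ^ e = 1}"
    then have "x \<noteq> 0"
      using pos by (auto simp: power_0_left)
    then have "x \<in> (\<lambda>i. \<theta> ^ i) ` {..<N}"
      using bij_betw_imp_surj_on[OF bij_betw_theta] by simp
    then obtain i where i: "i < N" "x = \<theta> ^ i"
      by auto
    then have "N dvd i * e"
      using x by (simp add: power_mult[symmetric] theta_power_eq_1_iff)
    then have "f dvd i"
      using pos f by simp
    then obtain j where "i = f * j"
      by auto
    then show "x \<in> (\<lambda>i. \<theta> ^ i) ` ((*) f ` {..<e})"
      using i f pos by auto
  qed (use f in \<open>auto simp: power_mult[symmetric] theta_power_eq_1_iff\<close>)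
  moreover have "inj_on (\<lambda>i. \<theta> ^ i) ((*) f ` {..<e})"
    by (rule inj_on_subset[OF bij_betw_imp_inj_on[OF bij_betw_theta]]) (use f pos in auto)
  moreover have "inj_on ((*) f) {..<e}"
    using pos by (auto intro: inj_onI)
  ultimately show ?thesis
    by (simp add: card_image)
qed

section \<open>The subfield, the group of norm-one elements and polar coordinates\<close>

definition K :: "'a set" where "K = {x. x ^ Q = x}"
definition U :: "'a set" where "U = {x. x ^ (Q + 1) = 1}"

lemma K_0 [simp]: "0 \<in> K" and K_1 [simp]: "1 \<in> K"
  using Q_ge_2 by (auto simp: K_def)

lemma K_add: "x \<in> K \<Longrightarrow> y \<in> K \<Longrightarrow> x + y \<in> K"
  by (simp add: K_def add_power_Q)

lemma K_mult: "x \<in> K \<Longrightarrow> y \<in> K \<Longrightarrow> x * y \<in> K"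
  by (simp add: K_def power_mult_distrib)

lemma K_power: "x \<in> K \<Longrightarrow> x ^ k \<in> K"
  by (induction k) (simp_all add: K_mult)

lemma K_divide: "x \<in> K \<Longrightarrow> y \<in> K \<Longrightarrow> x / y \<in> K"
  by (simp add: K_def power_divide)

lemma K_sum: "(\<And>i. i \<in> I \<Longrightarrow> f i \<in> K) \<Longrightarrow> sum f I \<in> K"
  by (induction I rule: infinite_finite_induct) (simp_all add: K_add)

text \<open>Describes the nonzero part of \<open>K\<close> as a group of roots of unity, which gives
  its size.\<close>

lemma K_nonzero_iff: "x \<in> K \<and> x \<noteq> 0 \<longleftrightarrow> x ^ (Q - 1) = 1"
proof -
  have "x ^ Q = x * x ^ (Q - 1)"
    using Q_ge_2 by (simp add: power_eq_if)
  then show ?thesis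
    using Q_ge_2 by (auto simp: K_def power_0_left)
qed

lemma card_K_nonzero: "card (K - {0}) = Q - 1"
proof -
  have "K - {0} = {x. x ^ (Q - 1) = 1}"
    using K_nonzero_iff by auto
  then show ?thesis
    using card_roots_of_unity[of "Q - 1"] by (simp add: N_factor)
qed

lemma card_K: "card K = Q"
proof -
  have "card K = Suc (card (K - {0}))"
    by (subst card_Suc_Diff1) auto
  then show ?thesis
    using card_K_nonzero Q_ge_2 by simp
qed

lemma card_U: "card U = Q + 1"
  unfolding U_def by (rule card_roots_of_unity) (simp only: N_factor dvd_triv_right)

lemma U_nonzero: "z \<in> U \<Longrightarrow> z \<noteq> 0"
  by (auto simp: U_def)

lemma U_mult: "z \<in> U \<Longrightarrow> w \<in> U \<Longrightarrow> z * w \<in> U"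
  by (simp only: U_def mem_Collect_eq power_mult_distrib mult_1_left)

lemma U_power: "z \<in> U \<Longrightarrow> z ^ k \<in> U"
  unfolding U_def mem_Collect_eq power_mult[symmetric] mult.commute[of k]
  unfolding power_mult by (simp only: power_one)

lemma U_divide: "z \<in> U \<Longrightarrow> w \<in> U \<Longrightarrow> z / w \<in> U"
  by (simp only: U_def mem_Collect_eq power_divide div_by_1)

lemma power_eq_if_square_eq: "x = y" if "x ^ 2 = y ^ 2" for x y :: 'a
proof -
  have "(x + y) ^ (2 ^ 1) = 0"
    unfolding add_power_2_power using that by simp
  then show ?thesis
    by (simp add: add_eq_0_iff_eq)
qed

text \<open>The norm \<open>(y * z) ^ (Q + 1)\<close> equals \<open>y ^ 2\<close>, and squaring is
  injective, so the product determines \<open>y\<close> and then \<open>z\<close>. Surjectivity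
  follows from \<open>(Q - 1) * (Q + 1) = N\<close>.\<close>

lemma bij_betw_polar: "bij_betw (\<lambda>(y, z). y * z) ((K - {0}) \<times> U) (UNIV - {0})"
proof -
  have "inj_on (\<lambda>(y, z). y * z) ((K - {0}) \<times> U)"
  proof (rule inj_onI)
    fix p p' assume p: "p \<in> (K - {0}) \<times> U" "p' \<in> (K - {0}) \<times> U"
      and "(case p of (y, z) \<Rightarrow> y * z) = (case p' of (y, z) \<Rightarrow> y * z)"
    then obtain y z y' z' where pp: "p = (y, z)" "p' = (y', z')" and eq: "y * z = y' * z'"
      by (cases p; cases p') auto
    then have yz: "y \<in> K" "y \<noteq> 0" "y' \<in> K" "y' \<noteq> 0" "z \<in> U" "z' \<in> U"
      using p by auto
    have sq: "(y * z) ^ (Q + 1) = y ^ 2" if "y \<in> K" "z \<in> U" for y z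
      using that by (simp add: K_def U_def power_mult_distrib power2_eq_square mult_ac)
    have "y = y'"
      by (rule power_eq_if_square_eq) (metis sq yz eq)
    then show "p = p'"
      using eq yz pp by simp
  qed
  moreover have "card ((K - {0}) \<times> U) = card (UNIV - {0 :: 'a})"
    using card_U card_K_nonzero by (simp add: card_cartesian_product card_Diff_subset card_UNIV_eq N_factor)
  moreover have "(\<lambda>(y, z). y * z) ` ((K - {0}) \<times> U) \<subseteq> UNIV - {0}"
    using U_nonzero by auto
  ultimately show ?thesis
    unfolding bij_betw_def by (metis card_image card_subset_eq finite_code)
qed

section \<open>The relative trace onto the subfield and the absolute traces\<close>

definition tau :: "'a \<Rightarrow> 'a" where "tau x = x + x ^ Q"

lemma tau_0 [simp]: "tau 0 = 0"
  using Q_ge_2 by (simp add: tau_def)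

lemma tau_in_K: "tau x \<in> K"
  by (simp add: K_def tau_def add_power_Q power_Q_Q add.commute)

lemma tau_add: "tau (x + y) = tau x + tau y"
  by (simp add: tau_def add_power_Q ac_simps)

lemma tau_mult: "y \<in> K \<Longrightarrow> tau (y * x) = y * tau x"
  by (simp add: tau_def K_def power_mult_distrib distrib_left)

lemma tau_sum: "tau (\<Sum>i\<in>I. f i) = (\<Sum>i\<in>I. tau (f i))"
  by (induction I rule: infinite_finite_induct) (simp_all add: tau_add)

lemma tau_eq_0_iff: "tau x = 0 \<longleftrightarrow> x \<in> K"
  by (auto simp: tau_def K_def add_eq_0_iff_eq)

text \<open>For \<open>k = m\<close> this restricts to the absolute trace of \<open>K\<close>; for
  \<open>k = 2 * m\<close> it is the absolute trace of the whole field.\<close>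

definition Tr :: "nat \<Rightarrow> 'a \<Rightarrow> 'a" where "Tr k x = (\<Sum>i<k. x ^ (2 ^ i))"

lemma Tr_0 [simp]: "Tr k 0 = 0"
  by (simp add: Tr_def power_0_left)

lemma Tr_add: "Tr k (x + y) = Tr k x + Tr k y"
  by (simp add: Tr_def add_power_2_power sum.distrib)

text \<open>The kernel consists of the roots of a nonzero polynomial of degree at most
  \<open>2 ^ (k - 1)\<close>.\<close>

lemma card_Tr_kernel:
  assumes "k \<ge> 1"
  shows "card {x. Tr k x = 0} \<le> 2 ^ (k - 1)"
proof -
  let ?p = "\<Sum>i<k. monom (1 :: 'a) (2 ^ i)"
  \<comment> \<open>Only the summand with \<open>i = 0\<close> has a linear term, so this
    coefficient shows that the polynomial is nonzero.\<close>
  have "coeff ?p 1 = (\<Sum>i<k. if i = 0 then 1 else 0)"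
    unfolding coeff_sum by (intro sum.cong) (auto simp: power_eq_if)
  also have "\<dots> = 1"
    using assms by simp
  finally have "?p \<noteq> 0"
    by (metis coeff_0 zero_neq_one)
  then have "card {x. poly ?p x = 0} \<le> degree ?p"
    by (rule card_poly_roots_bound)
  also have "degree ?p \<le> 2 ^ (k - 1)"
    by (intro degree_sum_le) (auto simp: degree_monom_eq intro: power_increasing)
  finally show ?thesis
    by (simp add: poly_sum poly_monom Tr_def)
qed

text \<open>The kernel has at most \<open>2 ^ (m - 1)\<close> elements and cannot contain the
  \<open>2 ^ m\<close> elements of \<open>K\<close>.\<close>

lemma Tr_nontrivial_on_K: "\<exists>x\<in>K. Tr m x \<noteq> 0"
proof (rule ccontr)
  assume "\<not> ?thesis"
  then have "card K \<le> card {x. Tr m x = 0}"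
    by (intro card_mono) auto
  then have "2 ^ m \<le> (2 :: nat) ^ (m - 1)"
    unfolding card_K Q_def using card_Tr_kernel[OF m_pos] by (rule le_trans)
  then show False
    using m_pos by (simp add: power_increasing_iff)
qed

text \<open>Transitivity of the trace: the terms with index at least \<open>m\<close> form the trace
  sum of the conjugate \<open>x ^ Q\<close>.\<close>

lemma Tr_double: "Tr (2 * m) x = Tr m (tau x)"
proof -
  have "(\<Sum>i<m + k. x ^ (2 ^ i)) = (\<Sum>i<m. x ^ (2 ^ i)) + (\<Sum>i<k. (x ^ Q) ^ (2 ^ i))" for k
    by (induction k) (simp_all add: add.assoc Q_def power_mult[symmetric] power_add)
  from this[of m] show ?thesis
    by (simp add: tau_def Tr_add mult_2) (simp add: Tr_def)
qed

lemma Tr_tau_nontrivial: "\<exists>x. Tr m (tau x) \<noteq> 0"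
proof (rule ccontr)
  assume "\<not> ?thesis"
  then have "{x. Tr (2 * m) x = 0} = UNIV"
    by (simp add: Tr_double)
  then have "2 ^ (2 * m) \<le> (2 :: nat) ^ (2 * m - 1)"
    using card_Tr_kernel[of "2 * m"] m_pos card_UNIV by simp
  then show False
    using m_pos by (simp add: power_increasing_iff)
qed

text \<open>On \<open>K\<close> squaring permutes the summands cyclically, because
  \<open>x ^ (2 ^ m) = x\<close>. The trace is then its own square, hence 0 or 1.\<close>

lemma Tr_square_self:
  assumes "x \<in> K"
  shows "Tr m (x ^ 2) = Tr m x" and "Tr m x ^ 2 = Tr m x"
proof -
  have "x + Tr m (x ^ 2) = (\<Sum>i<Suc m. x ^ (2 ^ i))"
    by (subst sum.lessThan_Suc_shift) (simp add: Tr_def power_mult)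
  also have "\<dots> = Tr m x + x"
    using assms by (simp add: Tr_def K_def Q_def)
  finally show 1: "Tr m (x ^ 2) = Tr m x"
    by simp
  have sq: "(\<Sum>i\<in>I. f i) ^ 2 = (\<Sum>i\<in>I. f i ^ 2)" for f :: "nat \<Rightarrow> 'a" and I
    by (induction I rule: infinite_finite_induct)
      (use add_power_2_power[of _ _ 1] in simp_all)
  have "Tr m x ^ 2 = Tr m (x ^ 2)"
    unfolding Tr_def sq by (simp add: power_mult[symmetric] mult.commute)
  with 1 show "Tr m x ^ 2 = Tr m x"
    by simp
qed

lemma Tr_cases:
  assumes "x \<in> K"
  shows "Tr m x = 0 \<or> Tr m x = 1"
  using Tr_square_self(2)[OF assms] by (auto simp: power2_eq_square)

text \<open>Meaningful on \<open>K\<close> only, where \<open>Tr m\<close> takes its values in the prime field.\<close>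

definition bit_trace :: "'a \<Rightarrow> bit" where "bit_trace x = (if Tr m x = 0 then 0 else 1)"

lemma bit_trace_0 [simp]: "bit_trace 0 = 0"
  by (simp add: bit_trace_def)

lemma bit_trace_eq_0_iff: "bit_trace x = 0 \<longleftrightarrow> Tr m x = 0"
  by (simp add: bit_trace_def)

lemma bit_trace_add: "x \<in> K \<Longrightarrow> y \<in> K \<Longrightarrow> bit_trace (x + y) = bit_trace x + bit_trace y"
  using Tr_cases[of x] Tr_cases[of y] by (auto simp: bit_trace_def Tr_add)

lemma bit_trace_square: "x \<in> K \<Longrightarrow> bit_trace (x ^ 2) = bit_trace x"
  by (simp add: bit_trace_def Tr_square_self)

lemma bit_trace_sum:
  "(\<And>i. i \<in> I \<Longrightarrow> f i \<in> K) \<Longrightarrow> bit_trace (\<Sum>i\<in>I. f i) = (\<Sum>i\<in>I. bit_trace (f i))"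
  by (induction I rule: infinite_finite_induct) (simp_all add: bit_trace_add K_sum)

lemma bit_trace_of_bit_mult: "bit_trace (of_bit c * x) = c * bit_trace x"
  by (cases c) auto

lemma bit_trace_nontrivial_on_K: "\<exists>x\<in>K. bit_trace x = 1"
  using Tr_nontrivial_on_K by (auto simp: bit_trace_def)

text \<open>Translation by \<open>x / k\<close>, where \<open>x\<close> has trace 1, flips the trace
  of \<open>y * k\<close>, so exactly half of \<open>K\<close> has trace 1.\<close>

lemma card_bit_trace_mult:
  assumes "k \<in> K" "k \<noteq> 0"
  shows "2 * card {y \<in> K - {0}. bit_trace (y * k) = 1} = Q"
proof -
  obtain x where x: "x \<in> K" "bit_trace x = 1"
    using bit_trace_nontrivial_on_K by blast
  have xk: "x / k \<in> K"
    using assms x by (simp add: K_divide)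
  have bij: "bij_betw ((+) (x / k)) K K"
    by (intro bij_betwI[where g = "(+) (x / k)"]) (use xk in \<open>auto simp: K_add add.assoc[symmetric]\<close>)
  have "2 * card {y \<in> K. bit_trace (y * k) = 1} = card K"
  proof (rule card_balanced[OF _ bij])
    fix y assume "y \<in> K"
    then have "bit_trace ((x / k + y) * k) = 1 + bit_trace (y * k)"
      using assms x by (simp add: distrib_right bit_trace_add K_mult)
    then show "(bit_trace ((x / k + y) * k) = 1) = (\<not> bit_trace (y * k) = 1)"
      by (cases "bit_trace (y * k)") auto
  qed simp
  \<comment> \<open>The element 0 has trace 0, so leaving it out does not change the count.\<close>
  moreover have "{y \<in> K - {0}. bit_trace (y * k) = 1} = {y \<in> K. bit_trace (y * k) = 1}"
    by auto
  ultimately show ?thesis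
    by (simp add: card_K)
qed

end

subsection \<open>The weights of the trace code\<close>

context quadratic_char_2
begin

definition W :: "'a set" where "W = (\<lambda>z. z ^ d) ` U"
text \<open>Equals the gcd of 2t - 1 and \<open>Q + 1\<close>, since \<open>d\<close> is congruent
  to 1 - 2t modulo \<open>Q + 1\<close>.\<close>

definition l :: nat where "l = gcd d (Q + 1)"
definition r :: nat where "r = card W"

lemma W_subset_U: "W \<subseteq> U"
  by (auto simp: W_def U_power)

text \<open>The common solutions of \<open>z ^ d = 1\<close> and \<open>z ^ (Q + 1) = 1\<close> are
  the roots of unity for the gcd of the exponents, and \<open>l\<close> divides
  \<open>N\<close>.\<close>

lemma card_kernel_power_d: "card {z \<in> U. z ^ d = 1} = l"
proof -
  have "{z \<in> U. z ^ d = 1} = {z. z ^ l = 1}"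
  proof (intro equalityI subsetI)
    fix z assume z: "z \<in> {z \<in> U. z ^ d = 1}"
    then have "z \<noteq> 0"
      using U_nonzero by auto
    then obtain k where k: "z = \<theta> ^ k"
      by (rule theta_power_cases)
    have "N dvd k * d" "N dvd k * (Q + 1)"
      using z unfolding theta_power_eq_1_iff[symmetric] power_mult k U_def by auto
    then have "N dvd k * l"
      unfolding l_def by (metis gcd_greatest gcd_mult_distrib_nat)
    then show "z \<in> {z. z ^ l = 1}"
      by (simp add: k power_mult[symmetric] theta_power_eq_1_iff)
  next
    fix z :: 'a assume z: "z \<in> {z. z ^ l = 1}"
    have "z ^ e = 1" if "l dvd e" for e
      using that z by (auto elim!: dvdE simp: power_mult)
    then show "z \<in> {z \<in> U. z ^ d = 1}"
      unfolding U_def l_def by blast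
  qed
  moreover have "l dvd N"
    unfolding l_def N_factor by (meson dvd_mult dvd_trans gcd_dvd2 dvd_refl)
  ultimately show ?thesis
    by (simp add: card_roots_of_unity)
qed

text \<open>Each nonempty fiber is a coset of the kernel.\<close>

lemma card_fiber_power_d:
  assumes "w \<in> W"
  shows "card {z \<in> U. z ^ d = w} = l"
proof -
  obtain u where u: "u \<in> U" "w = u ^ d"
    using assms by (auto simp: W_def)
  have nz: "u \<noteq> 0"
    using u U_nonzero by blast
  have "{z \<in> U. z ^ d = w} = (*) u ` {z \<in> U. z ^ d = 1}"
  proof (intro equalityI subsetI)
    fix z assume "z \<in> {z \<in> U. z ^ d = w}"
    then have "z / u \<in> {z \<in> U. z ^ d = 1}"
      using u nz U_divide by (simp add: power_divide)
    then show "z \<in> (*) u ` {z \<in> U. z ^ d = 1}"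
      using nz by (intro image_eqI[of _ _ "z / u"]) auto
  qed (use u U_mult in \<open>auto simp: power_mult_distrib\<close>)
  moreover have "inj_on ((*) u) {z \<in> U. z ^ d = 1}"
    using nz by (auto intro: inj_onI)
  ultimately show ?thesis
    by (simp add: card_image card_kernel_power_d)
qed

lemma card_vimage_power_d: "card {z \<in> U. P (z ^ d)} = l * card {w \<in> W. P w}"
proof -
  have "card {z \<in> U. P (z ^ d)} = (\<Sum>w\<in>W. \<Sum>z\<in>{z \<in> U. z ^ d = w}. if P (z ^ d) then 1 else 0)"
    unfolding W_def by (subst sum.image_gen[symmetric]) (simp_all add: sum.If_cases Int_def)
  also have "\<dots> = (\<Sum>w\<in>W. if P w then l else 0)"
    by (intro sum.cong) (auto simp: card_fiber_power_d)
  also have "\<dots> = l * card {w \<in> W. P w}"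
    by (simp add: sum.If_cases Int_def)
  finally show ?thesis .
qed

lemma r_mult_l: "r * l = Q + 1"
  using card_vimage_power_d[of "\<lambda>_. True"] card_U by (simp add: r_def)

lemma l_pos: "l > 0"
  using r_mult_l by (intro Nat.gr0I) simp

text \<open>As a divisor of the odd number \<open>Q + 1\<close>, \<open>r\<close> is odd;
  \<open>r = 1\<close> would make \<open>Q + 1\<close> divide \<open>d\<close>. Thus
  \<open>W\<close> has more elements than the quadratic equation has roots.\<close>

lemma r_ge_3: "r \<ge> 3"
proof -
  have "r \<noteq> 1"
  proof
    assume "r = 1"
    then have "l = Q + 1"
      using r_mult_l by simp
    then show False
      using Q_Suc_not_dvd_d unfolding l_def by (metis gcd_dvd1)
  qed
  moreover have "odd r"
    using r_mult_l even_Q by (metis even_mult_iff even_plus_one_iff)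
  ultimately show ?thesis
    by (cases "r = 2") (auto elim!: oddE)
qed

section \<open>The number of solutions of the quadratic equation and its moments\<close>

definition solutions :: "'a \<Rightarrow> 'a \<Rightarrow> 'a set" where
  "solutions a b = {w \<in> W. tau (b * w) = a}"

text \<open>The pair \<open>(0, 0)\<close> is left out because every element of \<open>W\<close> is
  a solution for it.\<close>

definition params :: "('a \<times> 'a) set" where
  "params = K \<times> UNIV - {(0, 0)}"

text \<open>Conjugation inverts the elements of \<open>U\<close>, so \<open>tau (b * w)\<close> is constant only on the two roots
  of a quadratic equation, whose product is \<open>b ^ Q / b\<close>.\<close>

lemma tau_eq_imp_mult_eq:
  assumes w: "w1 \<in> U" "w2 \<in> U" "w1 \<noteq> w2" and b: "b \<noteq> 0" and eq: "tau (b * w1) = tau (b * w2)"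
  shows "w1 * w2 = b ^ Q / b"
proof -
  have nz: "w1 \<noteq> 0" "w2 \<noteq> 0" "w1 + w2 \<noteq> 0"
    using w U_nonzero by (auto simp: add_eq_0_iff_eq)
  have inv: "w1 ^ Q * w1 = 1" "w2 ^ Q * w2 = 1"
    using w by (simp_all add: U_def power_add mult.commute)
  have "tau (b * (w1 + w2)) = 0"
    using eq by (simp add: distrib_left tau_add)
  then have "b ^ Q * (w1 ^ Q + w2 ^ Q) = b * (w1 + w2)"
    by (simp add: tau_eq_0_iff K_def power_mult_distrib add_power_Q)
  then have "b ^ Q * (w1 ^ Q + w2 ^ Q) * (w1 * w2) = b * (w1 + w2) * (w1 * w2)"
    by simp
  moreover have "(w1 ^ Q + w2 ^ Q) * (w1 * w2) = (w1 ^ Q * w1) * w2 + (w2 ^ Q * w2) * w1"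
    by (simp add: algebra_simps)
  ultimately have "b ^ Q * (w1 + w2) = b * (w1 * w2) * (w1 + w2)"
    unfolding inv by (simp add: mult.assoc) (simp add: ac_simps)
  then have "b ^ Q = b * (w1 * w2)"
    using nz by simp
  then show ?thesis
    using b by simp
qed

lemma solutions_b_0: "a \<noteq> 0 \<Longrightarrow> solutions a 0 = {}"
  by (auto simp: solutions_def)

text \<open>By the product formula, a solution \<open>w\<close> leaves only
  \<open>b ^ Q / b / w\<close> as a possible second one.\<close>

lemma card_solutions_le_2:
  assumes "(a, b) \<in> params"
  shows "card (solutions a b) \<le> 2"
proof (cases "b = 0")
  case True
  then show ?thesis
    using assms by (auto simp: params_def solutions_b_0)
next
  case False
  show ?thesis
  proof (cases "solutions a b = {}")
    case nonempty: False
    then obtain w where w: "w \<in> solutions a b"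
      by blast
    have "solutions a b \<subseteq> {w, b ^ Q / b / w}"
    proof
      fix v assume v: "v \<in> solutions a b"
      have UU: "w \<in> U" "v \<in> U"
        using v w W_subset_U by (auto simp: solutions_def)
      have "v = b ^ Q / b / w" if "v \<noteq> w"
      proof -
        have "w * v = b ^ Q / b"
          using tau_eq_imp_mult_eq[OF UU that[symmetric] False] v w by (simp add: solutions_def)
        moreover have "v = w * v / w"
          using U_nonzero[OF UU(1)] by simp
        ultimately show ?thesis
          by simp
      qed
      then show "v \<in> {w, b ^ Q / b / w}"
        by blast
    qed
    then have "card (solutions a b) \<le> card {w, b ^ Q / b / w}"
      by (intro card_mono) auto
    also have "\<dots> \<le> 2"
      by (simp add: card_insert_if)
    finally show ?thesis .
  qed simp
qed

text \<open>The value \<open>b\<close> determines \<open>a = tau (b * w1)\<close>, and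
  \<open>b = 0\<close> would give the excluded pair. The second condition says that
  \<open>b * (w1 + w2)\<close> lies in \<open>K\<close>: no restriction if \<open>w1 = w2\<close>,
  otherwise \<open>Q - 1\<close> nonzero choices.\<close>

lemma card_params_solution:
  assumes "w1 \<in> W" "w2 \<in> W"
  shows "card {p \<in> params. w1 \<in> solutions (fst p) (snd p) \<and> w2 \<in> solutions (fst p) (snd p)} =
    (if w1 = w2 then N else Q - 1)"
proof -
  have "{p \<in> params. w1 \<in> solutions (fst p) (snd p) \<and> w2 \<in> solutions (fst p) (snd p)} =
      (\<lambda>b. (tau (b * w1), b)) ` {b. b \<noteq> 0 \<and> tau (b * (w1 + w2)) = 0}" (is "?L = ?f ` ?B")
    using assms by (force simp: params_def solutions_def tau_in_K distrib_left tau_add add_eq_0_iff_eq)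
  moreover have "inj_on ?f ?B"
    by (auto intro: inj_onI)
  ultimately have "card ?L = card ?B"
    by (simp add: card_image)
  also have "\<dots> = (if w1 = w2 then N else Q - 1)"
  proof (cases "w1 = w2")
    case True
    then have "?B = UNIV - {0}"
      by auto
    then show ?thesis
      using True by (simp add: card_Diff_subset card_UNIV_eq)
  next
    case False
    then have nz: "w1 + w2 \<noteq> 0"
      by (simp add: add_eq_0_iff_eq)
    have "?B = (\<lambda>y. y / (w1 + w2)) ` (K - {0})"
      using nz by (auto simp: tau_eq_0_iff image_iff intro!: bexI[of _ "_ * (w1 + w2)"])
    moreover have "inj_on (\<lambda>y. y / (w1 + w2)) (K - {0})"
      using nz by (auto intro: inj_onI)
    ultimately show ?thesis
      using False by (simp add: card_image card_K_nonzero)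
  qed
  finally show ?thesis .
qed

lemma finite_params: "finite params" and finite_W: "finite W"
  by simp_all

lemma card_params: "card params + 1 = Q * (N + 1)"
proof -
  have "card params + 1 = card (K \<times> (UNIV :: 'a set))"
    unfolding params_def using card_Suc_Diff1[of "K \<times> (UNIV :: 'a set)" "(0, 0)"] by simp
  then show ?thesis
    by (simp add: card_cartesian_product card_K card_UNIV_eq)
qed

lemma sum_card_solutions: "(\<Sum>p\<in>params. card (solutions (fst p) (snd p))) = r * N"
proof -
  have "(\<Sum>p\<in>params. card {w \<in> W. w \<in> solutions (fst p) (snd p)}) = (\<Sum>w\<in>W. N)"
  proof (intro sum_multicount_gen ballI finite_params finite_W)
    fix w assume "w \<in> W"
    then show "card {p \<in> params. w \<in> solutions (fst p) (snd p)} = N"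
      using card_params_solution[of w w] by simp
  qed
  moreover have "{w \<in> W. w \<in> solutions (fst p) (snd p)} = solutions (fst p) (snd p)" for p
    by (auto simp: solutions_def)
  ultimately show ?thesis
    by (simp add: r_def)
qed

text \<open>The square counts ordered pairs of solutions: the \<open>r\<close> diagonal pairs occur
  for \<open>N\<close> parameters each, the \<open>r * (r - 1)\<close> others for
  \<open>Q - 1\<close>.\<close>

lemma sum_card_solutions_square:
  "(\<Sum>p\<in>params. card (solutions (fst p) (snd p)) ^ 2) = r * (N + (r - 1) * (Q - 1))"
proof -
  let ?S = "\<lambda>p. solutions (fst p) (snd p)"
  have "(\<Sum>p\<in>params. card {v \<in> W \<times> W. fst v \<in> ?S p \<and> snd v \<in> ?S p}) =
      (\<Sum>v\<in>W \<times> W. if fst v = snd v then N else Q - 1)"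
  proof (intro sum_multicount_gen ballI finite_params finite_SigmaI finite_W)
    fix v assume "v \<in> W \<times> W"
    then have "fst v \<in> W" "snd v \<in> W"
      by auto
    then show "card {p \<in> params. fst v \<in> ?S p \<and> snd v \<in> ?S p} =
        (if fst v = snd v then N else Q - 1)"
      by (rule card_params_solution)
  qed
  also have "\<dots> = (\<Sum>w1\<in>W. \<Sum>w2\<in>W. if w1 = w2 then N else Q - 1)"
    by (subst sum.cartesian_product) (simp add: case_prod_beta)
  also have "\<dots> = (\<Sum>w\<in>W. N + (r - 1) * (Q - 1))"
  proof (intro sum.cong refl)
    fix w assume w: "w \<in> W"
    have "(\<Sum>v\<in>W. if w = v then N else Q - 1) = N + (\<Sum>v\<in>W - {w}. if w = v then N else Q - 1)"
      using w by (subst sum.remove[of _ w]) auto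
    also have "(\<Sum>v\<in>W - {w}. if w = v then N else Q - 1) = (\<Sum>v\<in>W - {w}. Q - 1)"
      by (intro sum.cong) auto
    also have "\<dots> = (r - 1) * (Q - 1)"
      using w by (simp add: r_def)
    finally show "(\<Sum>v\<in>W. if w = v then N else Q - 1) = N + (r - 1) * (Q - 1)" .
  qed
  finally have "(\<Sum>p\<in>params. card {v \<in> W \<times> W. fst v \<in> ?S p \<and> snd v \<in> ?S p}) =
      r * (N + (r - 1) * (Q - 1))"
    by (simp add: r_def)
  moreover have "{v \<in> W \<times> W. fst v \<in> ?S p \<and> snd v \<in> ?S p} = ?S p \<times> ?S p" for p
    by (auto simp: solutions_def)
  ultimately show ?thesis
    by (simp add: card_cartesian_product power2_eq_square)
qed

section \<open>Frequencies of the solution numbers\<close>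

definition count :: "nat \<Rightarrow> nat" where
  "count j = card {p \<in> params. card (solutions (fst p) (snd p)) = j}"

text \<open>Taking \<open>f\<close> to be 1, \<open>j\<close> and \<open>j ^ 2\<close> yields three
  linear equations that determine the three frequencies.\<close>

lemma sum_over_counts:
  "(\<Sum>p\<in>params. f (card (solutions (fst p) (snd p)))) = f 0 * count 0 + f 1 * count 1 + f 2 * count 2"
  for f :: "nat \<Rightarrow> nat"
proof -
  let ?M = "\<lambda>p. card (solutions (fst p) (snd p))"
  have "(\<Sum>p\<in>params. f (?M p)) = (\<Sum>j\<in>{0, 1, 2}. \<Sum>p | p \<in> params \<and> ?M p = j. f (?M p))"
    using card_solutions_le_2 by (intro sum.group[symmetric] finite_params) (force simp: le_Suc_eq numeral_2_eq_2)+
  also have "\<dots> = (\<Sum>j\<in>{0, 1, 2}. f j * count j)"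
    by (intro sum.cong) (auto simp: count_def)
  finally show ?thesis
    by simp
qed

lemma count_1: "count 1 + 2 * count 2 = r * N"
  using sum_over_counts[of "\<lambda>j. j"] sum_card_solutions by simp

text \<open>Subtracting the first moment from the second eliminates \<open>count 1\<close>.\<close>

lemma count_2: "2 * count 2 = r * (r - 1) * (Q - 1)"
  using sum_over_counts[of "\<lambda>j. j ^ 2"] sum_card_solutions_square count_1
  by (simp add: distrib_left mult.assoc)

lemma count_0: "count 0 + count 1 + count 2 + 1 = Q * (N + 1)"
  using sum_over_counts[of "\<lambda>_. 1"] card_params by simp

section \<open>Codewords, their weights and the injectivity of the parametrization\<close>

definition codeword :: "'a \<Rightarrow> 'a \<Rightarrow> bit vec" where
  "codeword a b = vec N (\<lambda>i. bit_trace (a\<^sup>2 * (\<theta> ^ i) ^ (Q + 1) + tau (b * (\<theta> ^ i) ^ d)))"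

definition trace_code :: "bit vec set" where
  "trace_code = (\<lambda>(a, b). codeword a b) ` (K \<times> UNIV)"

text \<open>This is the norm to \<open>K\<close>: conjugation merely swaps its two factors.\<close>

lemma power_Q_Suc_in_K: "x ^ (Q + 1) \<in> K"
  unfolding K_def mem_Collect_eq power_add power_mult_distrib power_Q_Q power_one_right
  by (rule mult.commute)

lemma codeword_arg_in_K: "a \<in> K \<Longrightarrow> a\<^sup>2 * x ^ (Q + 1) + tau (b * x ^ d) \<in> K"
  by (intro K_add K_mult K_power tau_in_K power_Q_Suc_in_K)

text \<open>On the ray of \<open>z \<in> U\<close> the two quadratic terms merge into a linear form, because the trace is
  invariant under squaring.\<close>

lemma bit_trace_polar:
  assumes a: "a \<in> K" and y: "y \<in> K" "y \<noteq> 0" and z: "z \<in> U"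
  shows "bit_trace (a\<^sup>2 * (y * z) ^ (Q + 1) + tau (b * (y * z) ^ d)) =
    bit_trace (y * (a + tau (b * z ^ d)))"
proof -
  have "y ^ (Q - 1) = 1"
    using y K_nonzero_iff by blast
  then have "y ^ d = y"
    unfolding d_def power_add mult.commute[of t] power_mult by simp
  then have "tau (b * (y * z) ^ d) = tau (y * (b * z ^ d))"
    by (simp add: power_mult_distrib ac_simps)
  also have "\<dots> = y * tau (b * z ^ d)"
    using y by (simp add: tau_mult)
  finally have 1: "tau (b * (y * z) ^ d) = y * tau (b * z ^ d)" .
  have "y ^ (Q + 1) = y ^ 2" "z ^ (Q + 1) = 1"
    using y z by (simp_all add: K_def U_def power_add power2_eq_square)
  then have 2: "a\<^sup>2 * (y * z) ^ (Q + 1) = (y * a)\<^sup>2"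
    by (simp only: power_mult_distrib) simp
  have "bit_trace ((y * a)\<^sup>2 + y * tau (b * z ^ d)) = bit_trace (y * a) + bit_trace (y * tau (b * z ^ d))"
    using a y by (simp add: bit_trace_add bit_trace_square K_mult K_power tau_in_K)
  also have "\<dots> = bit_trace (y * (a + tau (b * z ^ d)))"
    using a y by (simp add: distrib_left bit_trace_add K_mult tau_in_K)
  finally show ?thesis
    unfolding 1 2 .
qed

text \<open>On the ray of \<open>z\<close> the entries are a linear functional of \<open>y\<close>:
  it contributes \<open>Q / 2\<close> ones, or none when the bracket vanishes. The equation is
  doubled and additive to avoid division and subtraction.\<close>

lemma hamming_weight_codeword:
  assumes a: "a \<in> K"
  shows "2 * hamming_weight (codeword a b) + Q * (l * card (solutions a b)) = Q * (Q + 1)"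
proof -
  let ?g = "\<lambda>x. bit_trace (a\<^sup>2 * x ^ (Q + 1) + tau (b * x ^ d))"
  let ?h = "\<lambda>z y. bit_trace (y * (a + tau (b * z ^ d)))"
  have "hamming_weight (codeword a b) = card {i \<in> {..<N}. ?g (\<theta> ^ i) = 1}"
    unfolding hamming_weight_def codeword_def by (intro arg_cong[where f = card]) auto
  also have "\<dots> = card {x \<in> UNIV - {0}. ?g x = 1}"
  proof (rule bij_betw_same_card[of "\<lambda>i. \<theta> ^ i"])
    show "bij_betw (\<lambda>i. \<theta> ^ i) {i \<in> {..<N}. ?g (\<theta> ^ i) = 1} {x \<in> UNIV - {0}. ?g x = 1}"
      by (rule bij_betw_Collect[OF bij_betw_theta]) simp
  qed
  also have "\<dots> = card {p \<in> (K - {0}) \<times> U. ?h (snd p) (fst p) = 1}"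
  proof (rule bij_betw_same_card[symmetric, of "\<lambda>(y, z). y * z"])
    show "bij_betw (\<lambda>(y, z). y * z) {p \<in> (K - {0}) \<times> U. ?h (snd p) (fst p) = 1}
        {x \<in> UNIV - {0}. ?g x = 1}"
      by (rule bij_betw_Collect[OF bij_betw_polar]) (use bit_trace_polar[OF a] in auto)
  qed
  also have "\<dots> = card (prod.swap ` (SIGMA z:U. {y \<in> K - {0}. ?h z y = 1}))"
    by (intro arg_cong[where f = card]) (auto simp: image_iff)
  also have "\<dots> = (\<Sum>z\<in>U. card {y \<in> K - {0}. ?h z y = 1})"
    by (subst card_image) (auto simp: card_SigmaI)
  finally have "2 * hamming_weight (codeword a b) = (\<Sum>z\<in>U. 2 * card {y \<in> K - {0}. ?h z y = 1})"
    by (simp only: sum_distrib_left)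
  also have "\<dots> = (\<Sum>z\<in>U. if tau (b * z ^ d) = a then 0 else Q)"
  proof (intro sum.cong refl)
    fix z
    show "2 * card {y \<in> K - {0}. ?h z y = 1} = (if tau (b * z ^ d) = a then 0 else Q)"
    proof (cases "tau (b * z ^ d) = a")
      case False
      then show ?thesis
        using a card_bit_trace_mult[of "a + tau (b * z ^ d)"]
        by (auto simp: K_add tau_in_K add_eq_0_iff_eq)
    qed simp
  qed
  \<comment> \<open>Adding \<open>Q\<close> for each vanishing ray makes every one of the
    \<open>Q + 1\<close> rays count \<open>Q\<close>.\<close>
  finally have "2 * hamming_weight (codeword a b) + (\<Sum>z\<in>U. if tau (b * z ^ d) = a then Q else 0) =
      (\<Sum>z\<in>U. (if tau (b * z ^ d) = a then 0 else Q) + (if tau (b * z ^ d) = a then Q else 0))"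
    by (simp only: sum.distrib)
  also have "\<dots> = (\<Sum>z\<in>U. Q)"
    by (intro sum.cong) auto
  also have "\<dots> = Q * (Q + 1)"
    by (simp add: card_U)
  also have "(\<Sum>z\<in>U. if tau (b * z ^ d) = a then Q else 0) = Q * card {z \<in> U. tau (b * z ^ d) = a}"
    by (simp add: sum.If_cases Int_def)
  also have "card {z \<in> U. tau (b * z ^ d) = a} = l * card (solutions a b)"
    unfolding solutions_def by (rule card_vimage_power_d)
  finally show ?thesis .
qed

lemma codeword_carrier [simp]: "codeword a b \<in> carrier_vec N"
  by (simp add: codeword_def)

lemma codeword_0 [simp]: "codeword 0 0 = 0\<^sub>v N"
  by (intro eq_vecI) (simp_all add: codeword_def)

lemma codeword_add:
  assumes "a \<in> K" "a' \<in> K"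
  shows "codeword (a + a') (b + b') = codeword a b + codeword a' b'"
proof (intro eq_vecI)
  fix i assume "i < dim_vec (codeword a b + codeword a' b')"
  then have i: "i < N"
    by (simp add: codeword_def)
  have sq: "(a + a')\<^sup>2 = a\<^sup>2 + a'\<^sup>2"
    using add_power_2_power[of a a' 1] by simp
  have "(a + a')\<^sup>2 * (\<theta> ^ i) ^ (Q + 1) + tau ((b + b') * (\<theta> ^ i) ^ d) =
      (a\<^sup>2 * (\<theta> ^ i) ^ (Q + 1) + tau (b * (\<theta> ^ i) ^ d)) +
      (a'\<^sup>2 * (\<theta> ^ i) ^ (Q + 1) + tau (b' * (\<theta> ^ i) ^ d))"
    unfolding sq distrib_right tau_add by (simp only: ac_simps)
  then show "codeword (a + a') (b + b') $ i = (codeword a b + codeword a' b') $ i"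
    using i bit_trace_add[OF codeword_arg_in_K codeword_arg_in_K, OF assms]
    by (simp only: codeword_def index_vec index_add_vec dim_vec)
qed (simp add: codeword_def)

text \<open>Weight 0 would require all \<open>r\<close> elements of \<open>W\<close> to be
  solutions, but \<open>r\<close> is at least 3 and nonzero parameters allow at most two.\<close>

lemma codeword_eq_0_iff:
  assumes "a \<in> K"
  shows "codeword a b = 0\<^sub>v N \<longleftrightarrow> a = 0 \<and> b = 0"
proof
  assume zero: "codeword a b = 0\<^sub>v N"
  show "a = 0 \<and> b = 0"
  proof (rule ccontr)
    assume "\<not> ?thesis"
    then have "card (solutions a b) \<le> 2"
      using assms by (intro card_solutions_le_2) (auto simp: params_def)
    then have "l * card (solutions a b) < l * r"
      using r_ge_3 l_pos by simp
    then have "l * card (solutions a b) < Q + 1"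
      using r_mult_l by (simp only: mult.commute[of l r])
    then have "Q * (l * card (solutions a b)) < Q * (Q + 1)"
      by (rule mult_strict_left_mono) (use Q_ge_2 in simp)
    moreover have "hamming_weight (codeword a b) = 0"
      unfolding zero by (simp add: hamming_weight_def)
    ultimately show False
      using hamming_weight_codeword[OF assms, of b] by simp
  qed
qed simp

lemma inj_on_codeword: "inj_on (\<lambda>(a, b). codeword a b) (K \<times> UNIV)"
proof (rule inj_onI, clarsimp)
  fix a b a' b' assume a: "a \<in> K" "a' \<in> K" and eq: "codeword a b = codeword a' b'"
  have "codeword (a + a') (b + b') = 0\<^sub>v N"
    unfolding codeword_add[OF a] eq by (rule bit_vec_add_self) simp
  then show "a = a' \<and> b = b'"
    using a by (simp add: codeword_eq_0_iff K_add add_eq_0_iff_eq)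
qed

lemma closed_trace_code: "closed_code N trace_code"
  unfolding closed_code_def
proof (intro conjI ballI)
  show "0\<^sub>v N \<in> trace_code"
    unfolding trace_code_def by (rule image_eqI[of _ _ "(0, 0)"]) auto
next
  fix x y assume "x \<in> trace_code" "y \<in> trace_code"
  then obtain a b a' b' where "a \<in> K" "a' \<in> K" "x = codeword a b" "y = codeword a' b'"
    by (auto simp: trace_code_def)
  then show "x + y \<in> trace_code"
    unfolding trace_code_def
    by (intro image_eqI[of _ _ "(a + a', b + b')"]) (auto simp: codeword_add K_add)
qed (auto simp: trace_code_def)

lemma card_trace_code: "card trace_code = 2 ^ (3 * m)"
  unfolding trace_code_def
  by (subst card_image[OF inj_on_codeword])
    (simp add: card_cartesian_product card_K card_UNIV Q_def power_add[symmetric])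

lemma card_trace_code_image:
  "card {c \<in> trace_code. c \<noteq> 0\<^sub>v N \<and> P c} = card {p \<in> params. P (codeword (fst p) (snd p))}"
proof -
  have "{c \<in> trace_code. c \<noteq> 0\<^sub>v N \<and> P c} =
      (\<lambda>(a, b). codeword a b) ` {p \<in> params. P (codeword (fst p) (snd p))}"
    by (auto simp: trace_code_def params_def codeword_eq_0_iff image_iff)
  then show ?thesis
    by (simp add: card_image inj_on_subset[OF inj_on_codeword] params_def)
qed

section \<open>Duality between the trace code and the cyclic code\<close>

lemma scalar_prod_codeword:
  assumes a: "a \<in> K" and c: "c \<in> carrier_vec N"
  shows "c \<bullet> codeword a b = bit_trace (a\<^sup>2 * (\<Sum>i<N. of_bit (c $ i) * (\<theta> ^ (Q + 1)) ^ i) +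
    tau (b * (\<Sum>i<N. of_bit (c $ i) * (\<theta> ^ d) ^ i)))"
proof -
  let ?x = "\<lambda>i. a\<^sup>2 * (\<theta> ^ i) ^ (Q + 1) + tau (b * (\<theta> ^ i) ^ d)"
  have of_bit_K: "of_bit e \<in> K" for e
    by (cases e) simp_all
  have swap: "(\<theta> ^ i) ^ e = (\<theta> ^ e) ^ i" for i e
    by (simp only: power_mult[symmetric] mult.commute)
  have "c \<bullet> codeword a b = (\<Sum>i<N. c $ i * bit_trace (?x i))"
    using c unfolding scalar_prod_def by (intro sum.cong) (auto simp: codeword_def)
  also have "\<dots> = (\<Sum>i<N. bit_trace (of_bit (c $ i) * ?x i))"
    by (simp only: bit_trace_of_bit_mult)
  also have "\<dots> = bit_trace (\<Sum>i<N. of_bit (c $ i) * ?x i)"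
    by (rule bit_trace_sum[symmetric]) (intro K_mult of_bit_K codeword_arg_in_K[OF a])
  also have "(\<Sum>i<N. of_bit (c $ i) * ?x i) =
      a\<^sup>2 * (\<Sum>i<N. of_bit (c $ i) * (\<theta> ^ (Q + 1)) ^ i) +
      (\<Sum>i<N. of_bit (c $ i) * tau (b * (\<theta> ^ d) ^ i))"
    unfolding sum_distrib_left sum.distrib[symmetric] swap[of _ "Q + 1"] swap[of _ d]
    by (intro sum.cong refl) (simp only: distrib_left ac_simps)
  also have "(\<Sum>i<N. of_bit (c $ i) * tau (b * (\<theta> ^ d) ^ i)) =
      tau (b * (\<Sum>i<N. of_bit (c $ i) * (\<theta> ^ d) ^ i))"
    unfolding sum_distrib_left tau_sum
    by (intro sum.cong refl) (simp only: tau_mult[OF of_bit_K, symmetric] mult.left_commute)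
  finally show ?thesis .
qed

text \<open>Orthogonality to all codewords is the vanishing of a trace form in \<open>a\<close> and
  \<open>b\<close>; its nondegeneracy forces both evaluations of the word to be 0.\<close>

lemma dual_trace_code:
  "dual_code N trace_code = {c \<in> carrier_vec N. (\<Sum>i<N. of_bit (c $ i) * (\<theta> ^ (Q + 1)) ^ i) = 0 \<and>
    (\<Sum>i<N. of_bit (c $ i) * (\<theta> ^ d) ^ i) = 0}"
proof -
  let ?A = "\<lambda>c :: bit vec. \<Sum>i<N. of_bit (c $ i) * (\<theta> ^ (Q + 1)) ^ i"
  let ?B = "\<lambda>c :: bit vec. \<Sum>i<N. of_bit (c $ i) * (\<theta> ^ d) ^ i"
  have nondegenerate: "A = 0 \<and> B = 0" if A: "A \<in> K" and zero: "\<And>a b. a \<in> K \<Longrightarrow> bit_trace (a\<^sup>2 * A + tau (b * B)) = 0" for A B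
  proof
    show "A = 0"
    proof (rule ccontr)
      assume nz: "A \<noteq> 0"
      obtain x where x: "x \<in> K" "bit_trace x = 1"
        using bit_trace_nontrivial_on_K by blast
      have xA: "x / A \<in> K"
        using x(1) A by (rule K_divide)
      \<comment> \<open>In \<open>K\<close> the power \<open>2 ^ (m - 1)\<close> is a square root,
        so some \<open>a\<close> in \<open>K\<close> satisfies \<open>a\<^sup>2 * A = x\<close>; it
        is tested with \<open>b = 0\<close>.\<close>
      have "2 ^ (m - 1) * 2 = Q"
        using m_pos power_minus_mult[of m "2 :: nat"] by (simp add: Q_def)
      then have "((x / A) ^ (2 ^ (m - 1)))\<^sup>2 = (x / A) ^ Q"
        by (simp only: power_mult[symmetric])
      also have "\<dots> = x / A"
        using xA by (simp add: K_def)
      finally show False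
        using zero[OF K_power[OF xA], of "2 ^ (m - 1)" 0] nz x by simp
    qed
    show "B = 0"
    proof (rule ccontr)
      assume nz: "B \<noteq> 0"
      obtain u where "Tr m (tau u) \<noteq> 0"
        using Tr_tau_nontrivial by blast
      then show False
        using zero[OF K_0, of "u / B"] nz by (simp add: bit_trace_eq_0_iff)
    qed
  qed
  have A_in_K: "?A c \<in> K" for c
  proof (intro K_sum K_mult K_power[OF power_Q_Suc_in_K])
    show "of_bit (c $ i) \<in> K" for i
      by (cases "c $ i") simp_all
  qed
  have "(\<forall>x\<in>trace_code. c \<bullet> x = 0) \<longleftrightarrow> ?A c = 0 \<and> ?B c = 0" if c: "c \<in> carrier_vec N" for c
  proof
    assume orth: "\<forall>x\<in>trace_code. c \<bullet> x = 0"
    have "bit_trace (a\<^sup>2 * ?A c + tau (b * ?B c)) = 0" if "a \<in> K" for a b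
    proof -
      have "codeword a b \<in> trace_code"
        using that by (auto simp: trace_code_def)
      then show ?thesis
        unfolding scalar_prod_codeword[OF that c, symmetric] using orth by blast
    qed
    then show "?A c = 0 \<and> ?B c = 0"
      by (rule nondegenerate[OF A_in_K])
  next
    assume zero: "?A c = 0 \<and> ?B c = 0"
    have "c \<bullet> codeword a b = 0" if "a \<in> K" for a b
      unfolding scalar_prod_codeword[OF that c] zero[THEN conjunct1] zero[THEN conjunct2] by simp
    then show "\<forall>x\<in>trace_code. c \<bullet> x = 0"
      by (auto simp: trace_code_def)
  qed
  then show ?thesis
    unfolding dual_code_def by blast
qed

lemma two_zero_code_eq_dual: "two_zero_code \<theta> (Q + 1) d = dual_code N trace_code"
proof -
  \<comment> \<open>X^Q - X separates the two zeros: it vanishes exactly on \<open>K\<close>, which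
    contains the norm \<open>\<theta> ^ (Q + 1)\<close> but not \<open>\<theta> ^ d\<close>.\<close>
  have root: "bit_eval (monom 1 Q - monom 1 1) x = x ^ Q - x" for x :: 'a
    by (simp add: bit_eval_diff[OF even_card] bit_eval_monom)
  have unity: "(\<theta> ^ k) ^ N = 1" for k
    using theta_nonzero by (intro power_N) simp
  have "\<theta> ^ d \<notin> K"
  proof
    assume "\<theta> ^ d \<in> K"
    then have "(\<theta> ^ d) ^ (Q - 1) = 1"
      using K_nonzero_iff[of "\<theta> ^ d"] theta_nonzero by simp
    then have "(Q - 1) * (Q + 1) dvd (Q - 1) * d"
      by (simp only: power_mult[symmetric] theta_power_eq_1_iff N_factor mult.commute[of d])
    then have "Q + 1 dvd d"
      by (rule dvd_mult_cancel) (use Q_ge_2 in simp)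
    then show False
      using Q_Suc_not_dvd_d by contradiction
  qed
  then have "bit_eval (monom 1 Q - monom 1 1) (\<theta> ^ d) \<noteq> 0"
    unfolding root by (simp add: K_def)
  moreover have "bit_eval (monom 1 Q - monom 1 1) (\<theta> ^ (Q + 1)) = 0"
    using power_Q_Suc_in_K[of \<theta>] unfolding root K_def by (simp only: mem_Collect_eq right_minus_eq)
  ultimately show ?thesis
    unfolding two_zero_code_def dual_trace_code card_UNIV_eq diff_Suc_1
    using cyclic_code_minimal_poly_mult[OF even_card unity unity N_pos] by blast
qed

lemma dual_two_zero_code: "dual_code N (two_zero_code \<theta> (Q + 1) d) = trace_code"
  unfolding two_zero_code_eq_dual by (rule dual_code_dual_code[OF closed_trace_code])

end

subsection \<open>The weight distribution\<close>

context quadratic_char_2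
begin

text \<open>The weight belonging to \<open>j\<close> solutions, taken in the integers so that the
  subtraction is not truncated.\<close>

definition weight :: "nat \<Rightarrow> int" where
  "weight j = 2 ^ (2 * m - 1) - (int j * int l - 1) * 2 ^ (m - 1)"

lemma double_weight: "2 * weight j = int Q * (int Q + 1 - int l * int j)"
proof -
  have "(2 :: int) ^ (2 * m - 1) * 2 = int Q * int Q"
    using power_minus_mult[of "2 * m" "2 :: int"] m_pos by (simp add: Q_def mult_2 power_add)
  moreover have "(2 :: int) ^ (m - 1) * 2 = int Q"
    using power_minus_mult[of m "2 :: int"] m_pos by (simp add: Q_def)
  moreover have "2 * weight j = 2 ^ (2 * m - 1) * 2 - (int j * int l - 1) * (2 ^ (m - 1) * 2)"
    by (simp add: weight_def)
  ultimately have "2 * weight j = int Q * int Q - (int j * int l - 1) * int Q"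
    by simp
  then show ?thesis
    by (simp add: algebra_simps)
qed

lemma hamming_weight_codeword_eq:
  assumes "a \<in> K"
  shows "int (hamming_weight (codeword a b)) = weight (card (solutions a b))"
proof -
  have "int (2 * hamming_weight (codeword a b) + Q * (l * card (solutions a b))) = int (Q * (Q + 1))"
    using hamming_weight_codeword[OF assms, of b] by (rule arg_cong)
  then have "2 * int (hamming_weight (codeword a b)) = 2 * weight (card (solutions a b))"
    unfolding double_weight by (simp add: algebra_simps)
  then show ?thesis
    by simp
qed

lemma weight_less:
  assumes "i < j"
  shows "weight j < weight i"
proof -
  have "int l * int i < int l * int j"
    using assms l_pos by simp
  then have "int Q * (int Q + 1 - int l * int j) < int Q * (int Q + 1 - int l * int i)"
    using Q_ge_2 by (intro mult_strict_left_mono) auto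
  then show ?thesis
    by (simp add: double_weight[symmetric])
qed

lemma weight_eq_iff: "weight i = weight j \<longleftrightarrow> i = j"
  using weight_less[of i j] weight_less[of j i] by (cases i j rule: linorder_cases) auto

text \<open>Since \<open>r\<close> is at least 3, \<open>l * j\<close> stays below
  \<open>l * r = Q + 1\<close>.\<close>

lemma weight_pos:
  assumes "j \<le> 2"
  shows "weight j > 0"
proof -
  have "l * j < l * r"
    using assms l_pos r_ge_3 by simp
  then have "int (l * j) < int (Q + 1)"
    unfolding mult.commute[of l r] r_mult_l by (simp only: of_nat_less_iff)
  then have "0 < int Q * (int Q + 1 - int l * int j)"
    using Q_ge_2 by (intro mult_pos_pos) auto
  then show ?thesis
    by (simp add: double_weight[symmetric])
qed

lemma hamming_weight_0 [simp]: "hamming_weight (0\<^sub>v N) = 0"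
  by (simp add: hamming_weight_def)

lemma nonzero_codeword_cases:
  assumes "c \<in> trace_code" "c \<noteq> 0\<^sub>v N"
  obtains j where "j \<le> 2" "int (hamming_weight c) = weight j"
proof -
  obtain a b where ab: "a \<in> K" "c = codeword a b"
    using assms by (auto simp: trace_code_def)
  then have "(a, b) \<in> params"
    using assms(2) by (auto simp: params_def)
  then have "card (solutions a b) \<le> 2"
    by (rule card_solutions_le_2)
  then show ?thesis
    using that hamming_weight_codeword_eq[OF ab(1), of b] ab(2) by blast
qed

lemma card_weight:
  assumes "j \<le> 2"
  shows "card {c \<in> trace_code. int (hamming_weight c) = weight j} = count j"
proof -
  have "{c \<in> trace_code. int (hamming_weight c) = weight j} =
      {c \<in> trace_code. c \<noteq> 0\<^sub>v N \<and> int (hamming_weight c) = weight j}"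
    using weight_pos[OF assms] by auto
  also have "card \<dots> = card {p \<in> params. int (hamming_weight (codeword (fst p) (snd p))) = weight j}"
    by (rule card_trace_code_image)
  also have "{p \<in> params. int (hamming_weight (codeword (fst p) (snd p))) = weight j} =
      {p \<in> params. card (solutions (fst p) (snd p)) = j}"
    by (auto simp: params_def hamming_weight_codeword_eq weight_eq_iff)
  finally show ?thesis
    by (simp add: count_def)
qed

lemma card_weight_0: "card {c \<in> trace_code. int (hamming_weight c) = 0} = 1"
proof -
  have "{c \<in> trace_code. int (hamming_weight c) = 0} = {0\<^sub>v N}"
  proof (intro equalityI subsetI)
    fix c assume c: "c \<in> {c \<in> trace_code. int (hamming_weight c) = 0}"
    show "c \<in> {0\<^sub>v N}"
    proof (rule ccontr)
      assume "c \<notin> {0\<^sub>v N}"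
      then obtain j where "j \<le> 2" "int (hamming_weight c) = weight j"
        using c nonzero_codeword_cases by blast
      then show False
        using c weight_pos[of j] by simp
    qed
  qed (use closed_trace_code in \<open>auto simp: closed_code_def\<close>)
  then show ?thesis
    by simp
qed

lemma count_pos: "count 0 > 0" "count 1 > 0" "count 2 > 0"
proof -
  \<comment> \<open>With \<open>b = 0\<close> the trace is always 0, so \<open>a = 1\<close> has no
    solution.\<close>
  have "(1, 0) \<in> {p \<in> params. card (solutions (fst p) (snd p)) = 0}"
    by (simp add: params_def solutions_b_0)
  then have "{p \<in> params. card (solutions (fst p) (snd p)) = 0} \<noteq> {}"
    by blast
  then show "count 0 > 0"
    unfolding count_def card_gt_0_iff by simp
  have "0 < r * (r - 1) * (Q - 1)"
    using r_ge_3 Q_ge_2 by simp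
  then show "count 2 > 0"
    using count_2 by linarith
  \<comment> \<open>From \<open>r - 1 < Q + 1\<close> it follows that \<open>2 * count 2\<close> is
    strictly smaller than \<open>r * N\<close>, which leaves a positive
    \<open>count 1\<close>.\<close>
  have "r \<le> r * l"
    using l_pos by simp
  then have "r - 1 < Q + 1"
    using r_mult_l r_ge_3 by linarith
  then have "r * (Q - 1) * (r - 1) < r * (Q - 1) * (Q + 1)"
    using r_ge_3 Q_ge_2 by (intro mult_strict_left_mono) auto
  then have "2 * count 2 < r * N"
    unfolding count_2 N_factor by (simp only: ac_simps)
  then show "count 1 > 0"
    using count_1 by linarith
qed

lemma weights_attained: "(\<lambda>c. int (hamming_weight c)) ` trace_code = {0, weight 2, weight 1, weight 0}"
proof (intro equalityI subsetI)
  fix x assume "x \<in> (\<lambda>c. int (hamming_weight c)) ` trace_code"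
  then obtain c where c: "c \<in> trace_code" "x = int (hamming_weight c)"
    by blast
  show "x \<in> {0, weight 2, weight 1, weight 0}"
  proof (cases "c = 0\<^sub>v N")
    case False
    then obtain j where "j \<le> 2" "x = weight j"
      using c nonzero_codeword_cases by metis
    then show ?thesis
      by (auto simp: le_Suc_eq numeral_2_eq_2)
  qed (use c in simp)
next
  have attained: "weight j \<in> (\<lambda>c. int (hamming_weight c)) ` trace_code" if "j \<le> 2" "count j > 0" for j
  proof -
    have "{c \<in> trace_code. int (hamming_weight c) = weight j} \<noteq> {}"
      using card_weight[OF that(1)] that(2) by (metis card.empty less_irrefl)
    then show ?thesis
      by force
  qed
  have "0 \<in> (\<lambda>c. int (hamming_weight c)) ` trace_code"
    using closed_trace_code by (intro image_eqI[of _ _ "0\<^sub>v N"]) (auto simp: closed_code_def)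
  then show "x \<in> (\<lambda>c. int (hamming_weight c)) ` trace_code" if "x \<in> {0, weight 2, weight 1, weight 0}" for x
    using that attained[of 0] attained[of 1] attained[of 2] count_pos by auto
qed

lemma is_linear_code_trace_code: "is_linear_code N (3 * m) (nat (weight 2)) trace_code"
proof -
  obtain c where c: "c \<in> trace_code" "int (hamming_weight c) = weight 2"
    using weights_attained by (metis (no_types, lifting) imageE insertCI)
  have "min_distance trace_code = nat (weight 2)"
  proof (rule min_distance_eqI[OF closed_trace_code c(1)])
    show "c \<noteq> 0\<^sub>v N"
      using c weight_pos[of 2] by auto
    show "hamming_weight c = nat (weight 2)"
      using c by simp
  next
    fix c' assume "c' \<in> trace_code" "c' \<noteq> 0\<^sub>v N"
    then obtain j where "j \<le> 2" "int (hamming_weight c') = weight j"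
      by (rule nonzero_codeword_cases)
    then show "nat (weight 2) \<le> hamming_weight c'"
      using weight_less[of j 2] by (cases "j = 2") auto
  qed
  then show ?thesis
    unfolding is_linear_code_def
    using subspace_closed_code[OF closed_trace_code] dim_closed_code[OF closed_trace_code card_trace_code]
    by blast
qed

text \<open>The moment equations are solved over the reals after substituting
  \<open>r = (Q + 1) / l\<close>.\<close>

lemma count_formulas:
  defines "L \<equiv> real l" and "Qr \<equiv> real Q"
  shows "real (count 2) = (Qr\<^sup>2 - 1) * (Qr - L + 1) / (2 * L\<^sup>2)" (is ?two)
    and "real (count 1) = (Qr\<^sup>2 - 1) * ((Qr + 2) * L - Qr - 1) / L\<^sup>2" (is ?one)
    and "real (count 0) = Qr ^ 3 - 1 + (Qr\<^sup>2 - 1) * (Qr + 1 - (2 * Qr + 3) * L) / (2 * L\<^sup>2)" (is ?zero)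
proof -
  have L: "L > 0"
    using l_pos by (simp add: L_def)
  have "real (r * l) = real (Q + 1)"
    using r_mult_l by simp
  then have R: "real r = (Qr + 1) / L"
    using L by (simp add: L_def Qr_def field_simps)
  have Q1: "real (Q - 1) = Qr - 1" and r1: "real (r - 1) = real r - 1"
    using Q_ge_2 r_ge_3 by (simp_all add: Qr_def of_nat_diff)
  have N: "real N = Qr\<^sup>2 - 1"
    unfolding N_factor of_nat_mult Q1 by (simp add: Qr_def power2_eq_square algebra_simps)
  have two: "2 * real (count 2) = real r * (real r - 1) * (Qr - 1)"
    using arg_cong[OF count_2, of real] by (simp only: of_nat_mult r1 Q1)
  then show ?two
    using L unfolding R by (simp add: field_simps power2_eq_square)
  have "real (count 1) + 2 * real (count 2) = real r * (Qr\<^sup>2 - 1)"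
    using arg_cong[OF count_1, of real] by (simp add: N)
  then have "real (count 1) = real r * (Qr\<^sup>2 - 1) - real r * (real r - 1) * (Qr - 1)"
    unfolding two by simp
  then show one: ?one
    using L by (simp only: R) (simp add: field_simps power2_eq_square)
  have "real (count 0) + real (count 1) + real (count 2) + 1 = Qr ^ 3"
    using arg_cong[OF count_0, of real] by (simp add: N Qr_def power3_eq_cube power2_eq_square algebra_simps)
  then have zero: "real (count 0) = Qr ^ 3 - 1 - real (count 1) - real (count 2)"
    by simp
  show ?zero
    unfolding zero one \<open>?two\<close> using L by (simp add: field_simps power2_eq_square)
qed

end

theorem theorem6:
  fixes \<theta> :: "'a::finite_field" and m n q d\<^sub>1 d\<^sub>2 :: nat and s\<^sub>2 l :: int
  assumes "m \<ge> 1" and "n = 2 * m" and "q = 2 ^ n"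
    and "CARD('a) = q"
    and "primitive_element \<theta>"
    and "d\<^sub>1 = 2 ^ m + 1"
    and "int d\<^sub>2 = s\<^sub>2 * (2 ^ m - 1) + 1" and "d\<^sub>2 > 0"
    and "\<not> [s\<^sub>2 = modular_inverse (2 ^ m + 1) 2] (mod (2 ^ m + 1))"
    and "l = gcd (2 * s\<^sub>2 - 1) (2 ^ m + 1)"
  shows "let C = dual_code (q - 1) (two_zero_code \<theta> d\<^sub>1 d\<^sub>2);
             w\<^sub>1 = 2 ^ (2 * m - 1) - (2 * l - 1) * 2 ^ (m - 1);
             w\<^sub>2 = 2 ^ (2 * m - 1) - (l - 1) * 2 ^ (m - 1);
             w\<^sub>3 = 2 ^ (2 * m - 1) + 2 ^ (m - 1);
             A = (\<lambda>w::int. real (card {c \<in> C. int (hamming_weight c) = w}));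
             L = real_of_int l
         in is_linear_code (2 ^ n - 1) (3 * m) (nat w\<^sub>1) C \<and>
            (\<lambda>c. int (hamming_weight c)) ` C = {0, w\<^sub>1, w\<^sub>2, w\<^sub>3} \<and>
            A 0 = 1 \<and>
            A w\<^sub>1 = (2 ^ (2 * m) - 1) * (2 ^ m - L + 1) / (2 * L ^ 2) \<and>
            A w\<^sub>2 = (2 ^ (2 * m) - 1) * ((2 ^ m + 2) * L - 2 ^ m - 1) / L ^ 2 \<and>
            A w\<^sub>3 = 2 ^ (3 * m) - 1 +
                     (2 ^ (2 * m) - 1) * (2 ^ m + 1 - (2 ^ (m + 1) + 3) * L) / (2 * L ^ 2)"
proof -
  define P :: int where "P = 2 ^ m"
  define t where "t = nat s\<^sub>2"
  have P_ge_2: "P \<ge> 2"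
    using power_increasing[OF assms(1), of "2 :: int"] by (simp add: P_def)
  \<comment> \<open>A negative \<open>s\<^sub>2\<close> would give \<open>d\<^sub>2\<close> at most
    \<open>2 - P\<close>, which is not positive.\<close>
  have "s\<^sub>2 \<ge> 0"
  proof (rule ccontr)
    assume "\<not> s\<^sub>2 \<ge> 0"
    then have "s\<^sub>2 * (P - 1) \<le> (- 1) * (P - 1)"
      using P_ge_2 by (intro mult_right_mono) auto
    then show False
      using assms(7,8) P_ge_2 by (simp add: P_def)
  qed
  then have t: "int t = s\<^sub>2"
    by (simp add: t_def)
  have "int d\<^sub>2 = int (t * (2 ^ m - 1) + 1)"
    unfolding assms(7) by (simp add: t of_nat_diff)
  then have d2: "d\<^sub>2 = t * (2 ^ m - 1) + 1"
    by (simp only: of_nat_eq_iff)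
  \<comment> \<open>Writing \<open>P - 1\<close> as \<open>(P + 1) - 2\<close> exposes the residue
    of \<open>d\<^sub>2\<close> modulo \<open>P + 1\<close>, which settles both the gcd and the
    divisibility.\<close>
  have d2_int: "int d\<^sub>2 = s\<^sub>2 * (P + 1) + - (2 * s\<^sub>2 - 1)"
    unfolding assms(7) P_def by (simp add: algebra_simps)
  have gcd_d2: "gcd (int d\<^sub>2) (P + 1) = l"
    unfolding d2_int gcd.commute[of _ "P + 1"] gcd_add_mult gcd_neg2
    by (simp add: assms(10) P_def gcd.commute)
  have not_dvd: "\<not> 2 ^ m + 1 dvd t * (2 ^ m - 1) + 1"
  proof
    assume "2 ^ m + 1 dvd t * (2 ^ m - 1) + 1"
    then have "int (2 ^ m + 1) dvd int d\<^sub>2"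
      unfolding d2 by (simp only: of_nat_dvd_iff)
    then have "P + 1 dvd int d\<^sub>2"
      by (simp add: P_def add.commute)
    then have "P + 1 dvd 2 * s\<^sub>2 - 1"
      unfolding d2_int by (metis dvd_add_right_iff dvd_minus_iff dvd_triv_right)
    then have "[2 * s\<^sub>2 = 1] (mod (P + 1))"
      by (simp add: cong_iff_dvd_diff)
    \<comment> \<open>\<open>P + 1\<close> is odd, so 2 can be cancelled and
      \<open>s\<^sub>2\<close> would be the excluded inverse of 2.\<close>
    moreover have cop: "coprime 2 (P + 1)"
      using assms(1) by (simp add: P_def)
    ultimately have "[2 * s\<^sub>2 = 2 * modular_inverse (P + 1) 2] (mod (P + 1))"
      using cong_modular_inverse1[OF cop] cong_sym cong_trans by blast
    then show False
      using assms(9) cop by (simp add: cong_mult_lcancel P_def)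
  qed
  interpret F: quadratic_char_2 \<theta> m t
    by unfold_locales (use assms not_dvd in auto)
  have FQ: "F.Q = 2 ^ m" and Fd: "F.d = d\<^sub>2"
    by (simp_all add: F.Q_def F.d_def d2)
  have "int F.l = gcd (int F.d) (int (F.Q + 1))"
    by (simp only: F.l_def gcd_int_int_eq)
  also have "\<dots> = gcd (int d\<^sub>2) (P + 1)"
    by (simp only: Fd FQ P_def of_nat_add of_nat_power of_nat_numeral of_nat_1)
  finally have l: "l = int F.l"
    by (simp only: gcd_d2)
  have N: "F.N = q - 1" and N': "F.N = 2 ^ n - 1"
    using assms by (simp_all add: F.N_def)
  have C: "dual_code (q - 1) (two_zero_code \<theta> d\<^sub>1 d\<^sub>2) = F.trace_code"
    using F.dual_two_zero_code unfolding FQ Fd N assms(6) .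
  have w: "2 ^ (2 * m - 1) - (2 * l - 1) * 2 ^ (m - 1) = F.weight 2"
    "2 ^ (2 * m - 1) - (l - 1) * 2 ^ (m - 1) = F.weight 1"
    "2 ^ (2 * m - 1) + 2 ^ (m - 1) = F.weight 0"
    by (simp_all add: F.weight_def l)
  have pow: "(2 :: real) ^ (2 * m) = (real F.Q)\<^sup>2" "(2 :: real) ^ (3 * m) = real F.Q ^ 3"
    "(2 :: real) ^ (m + 1) = 2 * real F.Q" "(2 :: real) ^ m = real F.Q"
    by (simp_all add: FQ power_mult[symmetric] mult.commute)
  have L: "real_of_int l = real F.l"
    by (simp add: l)
  show ?thesis
    unfolding Let_def C w pow L N'[symmetric] F.card_weight_0
      F.card_weight[OF order.refl] F.card_weight[of 0, OF zero_le] F.card_weight[of 1, OF one_le_numeral]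
      F.count_formulas
    using F.is_linear_code_trace_code F.weights_attained by simp
qed

end
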